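(* Let $\mathbb{K}$ be an algebraically closed field with $\operatorname{char}(\mathbb{K})>0$, and let $m,n\geq 2$ be integers. Let $M_{m,n}^2\subset\mathbb{K}^{mn}$ be the 2-generic determinantal variety, i.e. the variety of $(m\times n)$-matrices over $\mathbb{K}$ of rank less than $2$. Then the Nash blowup of $M_{m,n}^2$ is non-singular.
   Context: Generic determinantal variety: $M_{m,n}^2=\mathbf{V}(J_2)\subset\mathbb{K}^{mn}$, where $J_2\subset\mathbb{K}[x_{ij}\mid 1\leq i\leq m,1\leq j\leq n]$ is the ideal generated by all $(2\times 2)$-minors of the matrix $(x_{ij})$ of indeterminates. Nash blowup: let $X\subseteq\mathbb{K}^N$ be an equidimensional algebraic variety of dimension $d$. Consider the Gauss map $G:X\setminus\operatorname{Sing}(X)\to\operatorname{Gr}(d,N)$, $x\mapsto T_xX$, where $\operatorname{Gr}(d,N)$ is the Grassmannian of $d$-dimensional vector subspaces of $\mathbb{K}^N$ and $T_xX$ is the tangent space of $X$ at $x$. Let $X^*$ be the Zariski closure of the graph of $G$ (in $X\times\operatorname{Gr}(d,N)$) and let $\nu:X^*\to X$ be the restriction to $X^*$ of the projection $X\times\operatorname{Gr}(d,N)\to X$. The pair $(X^*,\nu)$ is called the Nash blowup of $X$; it is non-singular if $X^*$ is a non-singular variety. *)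

theory Defs
  imports
    "HOL-Analysis.Analysis"
    "HOL-Library.Poly_Mapping"
begin

section \<open>Polynomials in finitely many variables\<close>

text \<open>
  A polynomial maps monomials (exponent vectors) to coefficients, with finite support;
  the ring structure is the one of \<^type>\<open>poly_mapping\<close>.
\<close>

type_synonym ('v, 'k) mpoly = "('v \<Rightarrow>\<^sub>0 nat) \<Rightarrow>\<^sub>0 'k"

definition mvar :: "'v \<Rightarrow> ('v, 'k::comm_ring_1) mpoly" where
  "mvar i = Poly_Mapping.single (Poly_Mapping.single i 1) 1"

definition mono_eval :: "('v::finite \<Rightarrow>\<^sub>0 nat) \<Rightarrow> 'k::comm_ring_1 ^ 'v \<Rightarrow> 'k" where
  "mono_eval m x = (\<Prod>i\<in>UNIV. (x $ i) ^ Poly_Mapping.lookup m i)"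

definition mpoly_eval :: "('v::finite, 'k::comm_ring_1) mpoly \<Rightarrow> 'k ^ 'v \<Rightarrow> 'k" where
  "mpoly_eval p x = (\<Sum>m\<in>Poly_Mapping.keys p. Poly_Mapping.lookup p m * mono_eval m x)"

definition mpoly_pderiv :: "'v \<Rightarrow> ('v, 'k::comm_ring_1) mpoly \<Rightarrow> ('v, 'k) mpoly" where
  "mpoly_pderiv i p =
     (\<Sum>m\<in>Poly_Mapping.keys p.
        Poly_Mapping.single (m - Poly_Mapping.single i 1)
          (of_nat (Poly_Mapping.lookup m i) * Poly_Mapping.lookup p m))"

lemma mono_eval_0 [simp]: "mono_eval 0 x = 1"
  by (simp add: mono_eval_def)

lemma mono_eval_add: "mono_eval (m + m') x = mono_eval m x * mono_eval m' x"
  by (simp add: mono_eval_def lookup_add power_add prod.distrib)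

lemma mpoly_eval_0 [simp]: "mpoly_eval 0 x = 0"
  by (simp add: mpoly_eval_def)

lemma mpoly_eval_single: "mpoly_eval (Poly_Mapping.single m c) x = c * mono_eval m x"
  by (cases "c = 0") (simp_all add: mpoly_eval_def)

lemma mpoly_eval_1 [simp]: "mpoly_eval 1 x = 1"
  using mpoly_eval_single[of 0 1 x] by simp

lemma mpoly_eval_add: "mpoly_eval (p + q) x = mpoly_eval p x + mpoly_eval q x"
  unfolding mpoly_eval_def by (rule setsum_keys_plus_distrib) (simp_all add: distrib_right)

lemma mpoly_eval_uminus: "mpoly_eval (- p) x = - mpoly_eval p x"
  using mpoly_eval_add[of p "- p" x] by (simp add: eq_neg_iff_add_eq_0 add.commute)

lemma mpoly_eval_diff: "mpoly_eval (p - q) x = mpoly_eval p x - mpoly_eval q x"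
  using mpoly_eval_add[of p "- q" x] by (simp add: mpoly_eval_uminus)

lemma mpoly_eval_sum: "mpoly_eval (sum f A) x = (\<Sum>a\<in>A. mpoly_eval (f a) x)"
  by (induction A rule: infinite_finite_induct) (simp_all add: mpoly_eval_add)

lemma mpoly_eq_sum_single:
  "p = (\<Sum>m\<in>Poly_Mapping.keys p. Poly_Mapping.single m (Poly_Mapping.lookup p m))"
  by (rule poly_mapping_eqI)
     (auto simp: lookup_sum lookup_single when_def in_keys_iff sum.delta)

lemma mpoly_eval_mult:
  fixes p q :: "('v::finite, 'k::comm_ring_1) mpoly"
  shows "mpoly_eval (p * q) x = mpoly_eval p x * mpoly_eval q x"
proof -
  let ?K = "Poly_Mapping.keys" and ?l = "Poly_Mapping.lookup" and ?s = "Poly_Mapping.single"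
  have "p * q = (\<Sum>m\<in>?K p. ?s m (?l p m)) * (\<Sum>m\<in>?K q. ?s m (?l q m))"
    by (simp only: mpoly_eq_sum_single[symmetric])
  also have "\<dots> = (\<Sum>m\<in>?K p. \<Sum>m'\<in>?K q. ?s (m + m') (?l p m * ?l q m'))"
    by (simp add: sum_product mult_single)
  finally have "mpoly_eval (p * q) x =
      (\<Sum>m\<in>?K p. \<Sum>m'\<in>?K q. (?l p m * ?l q m') * mono_eval (m + m') x)"
    by (simp add: mpoly_eval_sum mpoly_eval_single)
  also have "\<dots> = mpoly_eval p x * mpoly_eval q x"
    by (simp add: mpoly_eval_def sum_product mono_eval_add mult_ac)
  finally show ?thesis .
qed

lemma mpoly_eval_mvar [simp]: "mpoly_eval (mvar i) x = x $ i"
proof -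
  have "mono_eval (Poly_Mapping.single i 1) x = (\<Prod>j\<in>UNIV. if j = i then x $ j else 1)"
    unfolding mono_eval_def by (rule prod.cong) (auto simp: lookup_single when_def)
  then show ?thesis
    by (simp add: mvar_def mpoly_eval_single)
qed


section \<open>Affine varieties\<close>

definition zero_locus :: "('v::finite, 'k::field) mpoly set \<Rightarrow> ('k ^ 'v) set" where
  "zero_locus S = {x. \<forall>p\<in>S. mpoly_eval p x = 0}"

definition vanishing_ideal :: "('k::field ^ 'v::finite) set \<Rightarrow> ('v, 'k) mpoly set" where
  "vanishing_ideal X = {p. \<forall>x\<in>X. mpoly_eval p x = 0}"

definition zariski :: "('k::field ^ 'v::finite) topology" where
  "zariski = topology (\<lambda>U. \<exists>S. U = - zero_locus S)"

lemma zero_locus_Union: "zero_locus (\<Union>\<S>) = (\<Inter>S\<in>\<S>. zero_locus S)"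
  by (auto simp: zero_locus_def)

lemma zero_locus_Un:
  "zero_locus S \<union> zero_locus T = zero_locus {p * q | p q. p \<in> S \<and> q \<in> T}"
proof (intro subset_antisym subsetI)
  fix x assume "x \<in> zero_locus {p * q | p q. p \<in> S \<and> q \<in> T}"
  then have "mpoly_eval p x * mpoly_eval q x = 0" if "p \<in> S" "q \<in> T" for p q
    using that unfolding zero_locus_def mpoly_eval_mult[symmetric] by blast
  then show "x \<in> zero_locus S \<union> zero_locus T"
    unfolding zero_locus_def by auto
qed (auto simp: zero_locus_def mpoly_eval_mult)

lemma istopology_zariski: "istopology (\<lambda>U :: ('k::field ^ 'v::finite) set. \<exists>S. U = - zero_locus S)"
  unfolding istopology_def
proof (intro conjI allI impI)
  fix U V :: "('k ^ 'v) set"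
  assume "\<exists>S. U = - zero_locus S" "\<exists>S. V = - zero_locus S"
  then show "\<exists>S. U \<inter> V = - zero_locus S"
    by (auto simp: zero_locus_Un simp flip: Compl_Un)
next
  fix \<K> :: "('k ^ 'v) set set"
  assume "\<forall>K\<in>\<K>. \<exists>S. K = - zero_locus S"
  then obtain S where "\<And>K. K \<in> \<K> \<Longrightarrow> K = - zero_locus (S K)"
    by metis
  then have "\<Union>\<K> = - zero_locus (\<Union>(S ` \<K>))"
    unfolding zero_locus_Union by auto
  then show "\<exists>S. \<Union>\<K> = - zero_locus S"
    by blast
qed

lemma openin_zariski: "openin zariski U \<longleftrightarrow> (\<exists>S. U = - zero_locus S)"
  unfolding zariski_def by (simp add: topology_inverse'[OF istopology_zariski])

lemma topspace_zariski [simp]: "topspace zariski = UNIV"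
proof -
  have "UNIV = - zero_locus {1 :: ('b, 'a) mpoly}"
    by (auto simp: zero_locus_def)
  then have "openin zariski (UNIV :: ('a ^ 'b) set)"
    unfolding openin_zariski by (rule exI)
  then show ?thesis
    by (auto dest: openin_subset)
qed

lemma closedin_zariski: "closedin zariski X \<longleftrightarrow> (\<exists>S. X = zero_locus S)"
  by (simp add: closedin_def openin_zariski flip: Compl_eq_Diff_UNIV)


section \<open>Dimension\<close>

definition irreducible_in :: "'a topology \<Rightarrow> 'a set \<Rightarrow> bool" where
  "irreducible_in T Z \<longleftrightarrow> Z \<subseteq> topspace T \<and> Z \<noteq> {} \<and>
     (\<forall>A B. closedin T A \<and> closedin T B \<and> Z \<subseteq> A \<union> B \<longrightarrow> Z \<subseteq> A \<or> Z \<subseteq> B)"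

definition irreducible_component :: "'a topology \<Rightarrow> 'a set \<Rightarrow> bool" where
  "irreducible_component T Z \<longleftrightarrow>
     irreducible_in T Z \<and> (\<forall>Z'. irreducible_in T Z' \<and> Z \<subseteq> Z' \<longrightarrow> Z' = Z)"

definition krull_dim :: "'a topology \<Rightarrow> enat" where
  "krull_dim T = Sup {enat n | n. \<exists>Z. (\<forall>i\<le>n. closedin T (Z i) \<and> irreducible_in T (Z i)) \<and>
                                      (\<forall>i<n. Z i \<subset> Z (Suc i))}"

definition variety_dim :: "('k::field ^ 'v::finite) set \<Rightarrow> enat" where
  "variety_dim X = krull_dim (subtopology zariski X)"

definition local_dim :: "('k::field ^ 'v::finite) set \<Rightarrow> 'k ^ 'v \<Rightarrow> enat" where
  "local_dim X x =
     Sup {variety_dim Z | Z. irreducible_component (subtopology zariski X) Z \<and> x \<in> Z}"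


section \<open>Tangent spaces and singular points\<close>

definition tangent_space :: "('k::field ^ 'v::finite) set \<Rightarrow> 'k ^ 'v \<Rightarrow> ('k ^ 'v) set" where
  "tangent_space X x =
     {v. \<forall>p\<in>vanishing_ideal X. (\<Sum>i\<in>UNIV. mpoly_eval (mpoly_pderiv i p) x * v $ i) = 0}"

definition nonsingular_at :: "('k::field ^ 'v::finite) set \<Rightarrow> 'k ^ 'v \<Rightarrow> bool" where
  "nonsingular_at X x \<longleftrightarrow> x \<in> X \<and> enat (vec.dim (tangent_space X x)) = local_dim X x"

definition Sing :: "('k::field ^ 'v::finite) set \<Rightarrow> ('k ^ 'v) set" where
  "Sing X = {x \<in> X. \<not> nonsingular_at X x}"


section \<open>The Grassmannian\<close>

definition Gr :: "nat \<Rightarrow> ('k::field ^ 'v::finite) set set" where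
  "Gr d = {W. vec.subspace W \<and> vec.dim W = d}"

text \<open>
  The standard affine charts of $\mathbb{K}^N \times \mathrm{Gr}(d,N)$: for a set \<open>B\<close> of \<open>d\<close>
  coordinates, the subspaces that project isomorphically onto $\mathbb{K}^B$ are exactly the graphs
  of the linear maps $\mathbb{K}^B \to \mathbb{K}^{-B}$ (\<open>- B\<close> is the complement), and the matrix entries of these maps are
  the coordinates of the chart. The coordinates \<open>Inl i\<close> belong to the factor $\mathbb{K}^N$.
  To have a single index type for all \<open>B\<close>, matrices are padded by zeros outside \<open>B \<times> - B\<close>, so that
  the domain $\mathbb{K}^N \times \mathbb{K}^{B \times -B}$ of the chart is realised as a coordinate
  subspace.
\<close>

definition chart_dom :: "'v::finite set \<Rightarrow> ('k::field ^ ('v + 'v \<times> 'v)) set" where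
  "chart_dom B = {y. \<forall>i j. \<not> (i \<in> B \<and> j \<notin> B) \<longrightarrow> y $ Inr (i, j) = 0}"

definition chart :: "'v::finite set \<Rightarrow> 'k::field ^ ('v + 'v \<times> 'v) \<Rightarrow> ('k ^ 'v) \<times> ('k ^ 'v) set" where
  "chart B y = (\<chi> i. y $ Inl i, {w. \<forall>j\<in>-B. w $ j = (\<Sum>i\<in>B. y $ Inr (i, j) * w $ i)})"

definition chart_preimage ::
    "'v::finite set \<Rightarrow> (('k::field ^ 'v) \<times> ('k ^ 'v) set) set \<Rightarrow> ('k ^ ('v + 'v \<times> 'v)) set" where
  "chart_preimage B Z = {y \<in> chart_dom B. chart B y \<in> Z}"

text \<open>The Zariski topology of $\mathbb{K}^N \times \mathrm{Gr}(d,N)$, glued from the charts.\<close>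

definition zariski_Gr :: "nat \<Rightarrow> (('k::field ^ 'v::finite) \<times> ('k ^ 'v) set) topology" where
  "zariski_Gr d = topology (\<lambda>U. U \<subseteq> UNIV \<times> Gr d \<and>
     (\<forall>B. card B = d \<longrightarrow> openin (subtopology zariski (chart_dom B)) (chart_preimage B U)))"

lemma istopology_zariski_Gr:
  "istopology (\<lambda>U :: (('k::field ^ 'v::finite) \<times> ('k ^ 'v) set) set. U \<subseteq> UNIV \<times> Gr d \<and>
     (\<forall>B. card B = d \<longrightarrow> openin (subtopology zariski (chart_dom B)) (chart_preimage B U)))"
proof -
  have Int: "chart_preimage B (U \<inter> V) = chart_preimage B U \<inter> chart_preimage B V"
    for B and U V :: "(('k ^ 'v) \<times> ('k ^ 'v) set) set"
    by (auto simp: chart_preimage_def)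
  have Union: "chart_preimage B (\<Union>\<K>) = \<Union>(chart_preimage B ` \<K>)"
    for B and \<K> :: "(('k ^ 'v) \<times> ('k ^ 'v) set) set set"
    by (auto simp: chart_preimage_def)
  show ?thesis
    unfolding istopology_def Int Union
    by (intro conjI allI impI openin_Int openin_Union) auto
qed

lemma openin_zariski_Gr:
  "openin (zariski_Gr d) U \<longleftrightarrow> U \<subseteq> UNIV \<times> Gr d \<and>
     (\<forall>B. card B = d \<longrightarrow> openin (subtopology zariski (chart_dom B)) (chart_preimage B U))"
  unfolding zariski_Gr_def by (simp add: topology_inverse'[OF istopology_zariski_Gr])

text \<open>
  Being non-singular is a local property and does not depend on the choice of an affine
  neighbourhood, so a locally closed subset of $\mathbb{K}^N \times \mathrm{Gr}(d,N)$ is tested at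
  each of its points in a chart containing the point.
\<close>

definition nonsingular_Gr :: "nat \<Rightarrow> (('k::field ^ 'v::finite) \<times> ('k ^ 'v) set) set \<Rightarrow> bool" where
  "nonsingular_Gr d Z \<longleftrightarrow>
     (\<forall>z\<in>Z. \<exists>B y. card B = d \<and> y \<in> chart_dom B \<and> chart B y = z \<and>
        nonsingular_at (chart_preimage B Z) y)"


section \<open>The Nash blowup\<close>

text \<open>
  Meaningful for an equidimensional variety \<open>X\<close>, whose dimension is then \<open>gauss_rank X\<close>;
  \<open>nash_blowup X\<close> is the space $X^*$, with $\nu$ being the restriction of \<open>fst\<close>.
\<close>

definition gauss_rank :: "('k::field ^ 'v::finite) set \<Rightarrow> nat" where
  "gauss_rank X = the_enat (variety_dim X)"

definition gauss_graph :: "('k::field ^ 'v::finite) set \<Rightarrow> (('k ^ 'v) \<times> ('k ^ 'v) set) set" where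
  "gauss_graph X = (\<lambda>x. (x, tangent_space X x)) ` (X - Sing X)"

definition nash_blowup :: "('k::field ^ 'v::finite) set \<Rightarrow> (('k ^ 'v) \<times> ('k ^ 'v) set) set" where
  "nash_blowup X =
     subtopology (zariski_Gr (gauss_rank X)) (X \<times> Gr (gauss_rank X)) closure_of gauss_graph X"

definition nonsingular_nash_blowup :: "('k::field ^ 'v::finite) set \<Rightarrow> bool" where
  "nonsingular_nash_blowup X \<longleftrightarrow> nonsingular_Gr (gauss_rank X) (nash_blowup X)"


section \<open>The 2-generic determinantal variety\<close>

definition minors2 :: "('m::finite \<times> 'n::finite, 'k::field) mpoly set" where
  "minors2 = {mvar (i, j) * mvar (i', j') - mvar (i, j') * mvar (i', j) | i i' j j'.
     i \<noteq> i' \<and> j \<noteq> j'}"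

definition J2 :: "('m::finite \<times> 'n::finite, 'k::field) mpoly set" where
  "J2 = module.span (*) minors2"

definition generic_det2 :: "('k::field ^ ('m::finite \<times> 'n::finite)) set" where
  "generic_det2 = zero_locus J2"

lemma module_mult: "module ((*) :: 'a::comm_ring_1 \<Rightarrow> 'a \<Rightarrow> 'a)"
  by unfold_locales (simp_all add: algebra_simps)

lemma zero_locus_ideal:
  fixes S :: "('v::finite, 'k::field) mpoly set"
  shows "zero_locus (module.span (*) S) = zero_locus S"
proof (rule subset_antisym; rule subsetI)
  fix x assume "x \<in> zero_locus (module.span (*) S)"
  then have "mpoly_eval p x = 0" if "p \<in> S" for p
    using that module.span_base[OF module_mult, of p S] by (simp add: zero_locus_def)
  then show "x \<in> zero_locus S"
    by (simp add: zero_locus_def)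
next
  fix x assume x: "x \<in> zero_locus S"
  let ?I = "{p. mpoly_eval p x = 0}"
  have "module.subspace (*) ?I"
    by (rule module.subspaceI[OF module_mult]) (simp_all add: mpoly_eval_add mpoly_eval_mult)
  moreover have "S \<subseteq> ?I"
    using x by (simp add: zero_locus_def subset_iff)
  ultimately have "module.span (*) S \<subseteq> ?I"
    using module.span_minimal[OF module_mult] by metis
  then show "x \<in> zero_locus (module.span (*) S)"
    by (simp add: zero_locus_def subset_iff)
qed

lemma generic_det2_minors:
  fixes x :: "'k::field ^ ('m::finite \<times> 'n::finite)"
  shows "x \<in> generic_det2 \<longleftrightarrow> (\<forall>i i' j j'. x $ (i, j) * x $ (i', j') = x $ (i, j') * x $ (i', j))"
proof -
  have ev: "mpoly_eval (mvar (i, j) * mvar (i', j') - mvar (i, j') * mvar (i', j)) x =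
      x $ (i, j) * x $ (i', j') - x $ (i, j') * x $ (i', j)" for i i' j j'
    by (simp add: mpoly_eval_diff mpoly_eval_mult)
  have "x \<in> generic_det2 \<longleftrightarrow> (\<forall>i i' j j'. i \<noteq> i' \<and> j \<noteq> j' \<longrightarrow>
      mpoly_eval (mvar (i, j) * mvar (i', j') - mvar (i, j') * mvar (i', j)) x = 0)"
    unfolding generic_det2_def J2_def zero_locus_ideal
  proof (intro iffI allI impI)
    fix i i' :: 'm and j j' :: 'n
    assume "x \<in> zero_locus minors2" "i \<noteq> i' \<and> j \<noteq> j'"
    moreover from this(2) have
      "mvar (i, j) * mvar (i', j') - mvar (i, j') * mvar (i', j) \<in>
        (minors2 :: ('m \<times> 'n, 'k) mpoly set)"
      unfolding minors2_def by blast
    ultimately show "mpoly_eval (mvar (i, j) * mvar (i', j') - mvar (i, j') * mvar (i', j)) x = 0"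
      unfolding zero_locus_def by blast
  next
    assume *: "\<forall>i i' j j'. i \<noteq> i' \<and> j \<noteq> j' \<longrightarrow>
      mpoly_eval (mvar (i, j) * mvar (i', j') - mvar (i, j') * mvar (i', j)) x = 0"
    show "x \<in> zero_locus minors2"
      unfolding zero_locus_def minors2_def
    proof (rule CollectI, rule ballI, elim CollectE exE conjE)
      fix p :: "('m \<times> 'n, 'k) mpoly" and i i' :: 'm and j j' :: 'n
      assume "p = mvar (i, j) * mvar (i', j') - mvar (i, j') * mvar (i', j)" "i \<noteq> i'" "j \<noteq> j'"
      then show "mpoly_eval p x = 0"
        using * by (simp only: simp_thms)
    qed
  qed
  also have "\<dots> \<longleftrightarrow> (\<forall>i i' j j'. i \<noteq> i' \<and> j \<noteq> j' \<longrightarrow>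
      x $ (i, j) * x $ (i', j') = x $ (i, j') * x $ (i', j))"
    by (simp add: ev)
  also have "\<dots> \<longleftrightarrow> (\<forall>i i' j j'. x $ (i, j) * x $ (i', j') = x $ (i, j') * x $ (i', j))"
  proof (intro iffI allI impI)
    fix i i' :: 'm and j j' :: 'n
    assume "\<forall>i i' j j'. i \<noteq> i' \<and> j \<noteq> j' \<longrightarrow>
      x $ (i, j) * x $ (i', j') = x $ (i, j') * x $ (i', j)"
    then show "x $ (i, j) * x $ (i', j') = x $ (i, j') * x $ (i', j)"
      by (cases "i = i' \<or> j = j'") (auto simp: mult.commute)
  qed simp
  finally show ?thesis .
qed

lemma generic_det2_rank: "generic_det2 = {x. rank (\<chi> i j. x $ (i, j)) < 2}"
proof (intro set_eqI)
  fix x :: "'k::field ^ ('m::finite \<times> 'n::finite)"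
  define A where "A = (\<chi> i j. x $ (i, j))"
  have A: "A $ i $ j = x $ (i, j)" for i j
    by (simp add: A_def)
  have rows: "rows A = range (($) A)"
    by (auto simp: rows_def row_def)
  have "rank A < 2" if x: "x \<in> generic_det2"
  proof (cases "A = 0")
    case True
    then have "rows A \<subseteq> vec.span {}"
      by (auto simp: rows vec_eq_iff)
    then have "vec.dim (rows A) \<le> card ({} :: ('k ^ 'n) set)"
      by (intro vec.dim_le_card) auto
    then show ?thesis
      unfolding row_rank_def_gen by (rule le_less_trans) simp
  next
    case False
    then obtain k l where kl: "x $ (k, l) \<noteq> 0"
      by (auto simp: vec_eq_iff A)
    have "A $ i = (x $ (i, l) / x $ (k, l)) *s A $ k" for i
      using x[unfolded generic_det2_minors, rule_format, of i l k] kl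
      by (simp add: vec_eq_iff A field_simps)
    then have "A $ i \<in> vec.span {A $ k}" for i
      by (metis vec.span_base vec.span_scale singletonI)
    then have "rows A \<subseteq> vec.span {A $ k}"
      by (auto simp: rows)
    then have "vec.dim (rows A) \<le> card {A $ k}"
      by (intro vec.dim_le_card) auto
    then show ?thesis
      unfolding row_rank_def_gen by (rule le_less_trans) simp
  qed
  moreover have "x \<in> generic_det2" if "rank A < 2"
  proof (rule ccontr)
    assume "x \<notin> generic_det2"
    then obtain i i' j j' where ne: "x $ (i, j) * x $ (i', j') \<noteq> x $ (i, j') * x $ (i', j)"
      unfolding generic_det2_minors by blast
    have nz: "A $ i' \<noteq> 0"
    proof
      assume "A $ i' = 0"
      then have "x $ (i', l) = 0" for l
        by (simp add: vec_eq_iff A)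
      then show False
        using ne by simp
    qed
    have nc: "A $ i \<noteq> c *s A $ i'" for c
    proof
      assume "A $ i = c *s A $ i'"
      then have "x $ (i, l) = c * x $ (i', l)" for l
        by (metis A vector_smult_component)
      then show False
        using ne by (simp add: mult_ac)
    qed
    have "A $ i \<noteq> A $ i'"
      using nc[of 1] by simp
    moreover have "A $ i \<notin> vec.span {A $ i'}"
      using nc by (auto simp: vec.span_singleton)
    ultimately have "vec.independent {A $ i, A $ i'}"
      using nz by (simp add: vec.independent_insert)
    moreover have "{A $ i, A $ i'} \<subseteq> rows A"
      by (simp add: rows)
    ultimately have "card {A $ i, A $ i'} \<le> vec.dim (rows A)"
      by (intro vec.independent_card_le_dim)
    then show False
      using that \<open>A $ i \<noteq> A $ i'\<close> by (simp add: row_rank_def_gen)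
  qed
  ultimately show "x \<in> generic_det2 \<longleftrightarrow> x \<in> {x. rank (\<chi> i j. x $ (i, j)) < 2}"
    by (auto simp: A_def)
qed

end

theory Submission
  imports Defs
begin

text \<open>
  A nonzero matrix \<open>x\<close> of rank one is an outer product of vectors \<open>u\<close> and \<open>v\<close>, unique up to scaling, and the
  tangent space of the determinantal variety \<open>X\<close> at \<open>x\<close> consists of the matrices
  \<open>outer u a + outer b v\<close>. It depends on the classes of \<open>u\<close> and \<open>v\<close> in the two projective spaces only,
  and it determines them. So the closure of the graph of the Gauss map should be the set of all
  pairs \<open>(t *s outer u v, rank1_tangent u v)\<close> with \<open>u\<close>, \<open>v\<close> nonzero, where now \<open>t = 0\<close> is permitted: the
  total space of the line bundle \<open>O(-1,-1)\<close> over a product of two projective spaces, which is smooth. Three things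
  make this precise.

  Dimension. The Krull dimension of \<open>X\<close> is needed both to know in which Grassmannian the tangent spaces lie and
  to decide which points are singular. \<open>variety_dim_parametrised\<close> computes it for any set that a
  polynomial map from affine space parametrises densely: along a chain of irreducible closed sets choose
  polynomials that vanish on one member but not on the next; they are algebraically independent, while
  more than \<open>d\<close> polynomials in \<open>d\<close> variables never are, because there are too few monomials
  (\<open>chain_length_le\<close>). It follows that \<open>X\<close> has dimension \<open>m + n - 1\<close> and that the origin is its only singular
  point.

  The closure (\<open>nash_blowup_generic_det2\<close>). The set of pairs above is closed since membership says that certain
  homogeneous linear systems, whose coefficients are polynomial in the coordinates of a chart,
  have nonzero solutions \<open>u\<close> and \<open>v\<close>; this is the vanishing of determinants (\<open>closedin_common_kernel\<close>). Every pair
  with \<open>t = 0\<close> is a limit of pairs with \<open>t \<noteq> 0\<close>.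

  Smoothness. Let \<open>u\<close> and \<open>v\<close> have nonzero entries at \<open>i0\<close> and \<open>j0\<close>, and normalise these to 1. In the chart given by the
  entries in row \<open>i0\<close> or column \<open>j0\<close>, a matrix in \<open>rank1_tangent u v\<close> satisfies
  \[ w_{ij} = u_i w_{i_0 j} + v_j w_{i j_0} - u_i v_j w_{i_0 j_0}, \]
  so the chart coordinates of the point are polynomials in \<open>t\<close>, the \<open>u_i\<close> and the \<open>v_j\<close>, and these parameters
  themselves occur among the coordinates. The Nash blowup is thus locally the graph of a polynomial map, which is
  non-singular (\<open>nonsingular_at_section_image\<close>).
\<close>

section \<open>Polynomial functions\<close>

definition polyfun :: "('k::field ^ 'v::finite \<Rightarrow> 'k) \<Rightarrow> bool" where
  "polyfun f \<longleftrightarrow> f \<in> range mpoly_eval"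

definition polymap :: "('k::field ^ 'u::finite \<Rightarrow> 'k ^ 'v::finite) \<Rightarrow> bool" where
  "polymap \<phi> \<longleftrightarrow> (\<forall>i. polyfun (\<lambda>x. \<phi> x $ i))"

lemma polyfun_mpoly_eval [simp]: "polyfun (mpoly_eval p)"
  by (simp add: polyfun_def)

lemma polyfunE:
  assumes "polyfun f" obtains p where "f = mpoly_eval p"
  using assms by (auto simp: polyfun_def)

lemma polyfun_const [simp]: "polyfun (\<lambda>x. c)"
  unfolding polyfun_def
  by (rule range_eqI[where x = "Poly_Mapping.single 0 c"]) (simp add: mpoly_eval_single fun_eq_iff)

lemma polyfun_coord [simp]: "polyfun (\<lambda>x. x $ i)"
  unfolding polyfun_def by (rule range_eqI[where x = "mvar i"]) (simp add: fun_eq_iff)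

lemma polyfun_add [simp]: "polyfun f \<Longrightarrow> polyfun g \<Longrightarrow> polyfun (\<lambda>x. f x + g x)"
  by (auto elim!: polyfunE simp flip: mpoly_eval_add)

lemma polyfun_diff [simp]: "polyfun f \<Longrightarrow> polyfun g \<Longrightarrow> polyfun (\<lambda>x. f x - g x)"
  by (auto elim!: polyfunE simp flip: mpoly_eval_diff)

lemma polyfun_uminus [simp]: "polyfun f \<Longrightarrow> polyfun (\<lambda>x. - f x)"
  by (auto elim!: polyfunE simp flip: mpoly_eval_uminus)

lemma polyfun_mult [simp]: "polyfun f \<Longrightarrow> polyfun g \<Longrightarrow> polyfun (\<lambda>x. f x * g x)"
  by (auto elim!: polyfunE simp flip: mpoly_eval_mult)

lemma polyfun_sum [simp]: "(\<And>a. a \<in> A \<Longrightarrow> polyfun (f a)) \<Longrightarrow> polyfun (\<lambda>x. \<Sum>a\<in>A. f a x)"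
  by (induction A rule: infinite_finite_induct) simp_all

lemma polyfun_prod [simp]: "(\<And>a. a \<in> A \<Longrightarrow> polyfun (f a)) \<Longrightarrow> polyfun (\<lambda>x. \<Prod>a\<in>A. f a x)"
  by (induction A rule: infinite_finite_induct) simp_all

lemma polyfun_power [simp]: "polyfun f \<Longrightarrow> polyfun (\<lambda>x. f x ^ n)"
  by (induction n) simp_all

lemma polyfun_if:
  "(P \<Longrightarrow> polyfun f) \<Longrightarrow> (\<not> P \<Longrightarrow> polyfun g) \<Longrightarrow> polyfun (\<lambda>x. if P then f x else g x)"
  by (cases P) simp_all

lemma mpoly_eval_prod: "mpoly_eval (prod f A) x = (\<Prod>a\<in>A. mpoly_eval (f a) x)"
  by (induction A rule: infinite_finite_induct) (simp_all add: mpoly_eval_mult)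

lemma mpoly_eval_power: "mpoly_eval (p ^ n) x = mpoly_eval p x ^ n"
  by (induction n) (simp_all add: mpoly_eval_mult)

lemma polyfun_compose:
  assumes "polyfun f" "polymap \<phi>"
  shows "polyfun (\<lambda>x. f (\<phi> x))"
proof -
  obtain p where "f = mpoly_eval p"
    using assms(1) by (rule polyfunE)
  then show ?thesis
    using assms(2) by (simp add: mpoly_eval_def mono_eval_def polymap_def)
qed

lemma closedin_zariski_polyfun:
  "closedin zariski Z \<longleftrightarrow> (\<exists>F. (\<forall>f\<in>F. polyfun f) \<and> Z = {x. \<forall>f\<in>F. f x = 0})"
proof
  assume "closedin zariski Z"
  then obtain S where "Z = zero_locus S"
    by (auto simp: closedin_zariski)
  then show "\<exists>F. (\<forall>f\<in>F. polyfun f) \<and> Z = {x. \<forall>f\<in>F. f x = 0}"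
    by (intro exI[of _ "mpoly_eval ` S"]) (auto simp: zero_locus_def)
next
  assume "\<exists>F. (\<forall>f\<in>F. polyfun f) \<and> Z = {x. \<forall>f\<in>F. f x = 0}"
  then obtain F where F: "\<forall>f\<in>F. polyfun f" and Z: "Z = {x. \<forall>f\<in>F. f x = 0}"
    by blast
  have "\<forall>f\<in>F. \<exists>p. f = mpoly_eval p"
    using F by (auto elim: polyfunE)
  then obtain P where "\<forall>f\<in>F. f = mpoly_eval (P f)"
    by metis
  then have "Z = zero_locus (P ` F)"
    by (auto simp: zero_locus_def Z)
  then show "closedin zariski Z"
    by (auto simp: closedin_zariski)
qed

text \<open>
  Over a finite field, adding 1 to the product of all linear factors gives a polynomial without roots.
\<close>

lemma infinite_alg_closed_field: "infinite (UNIV :: 'k::alg_closed_field set)"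
proof
  assume fin: "finite (UNIV :: 'k set)"
  define p :: "'k poly" where "p = (\<Prod>a\<in>UNIV. [:- a, 1:]) + 1"
  have "poly p x = 1" for x
    using fin by (simp add: p_def poly_prod prod_zero_iff)
  moreover have "degree (\<Prod>a\<in>(UNIV :: 'k set). [:- a, 1:]) = card (UNIV :: 'k set)"
    using degree_linear_power by (subst degree_prod_eq_sum_degree) auto
  moreover have "card (UNIV :: 'k set) > 0"
    using fin by (simp add: card_gt_0_iff)
  ultimately have "degree p > 0"
    by (simp add: p_def degree_add_eq_left)
  then show False
    using alg_closed_imp_poly_has_root[of p] \<open>\<And>x. poly p x = 1\<close> by auto
qed

lemma poly_eqI_infinite:
  fixes P Q :: "'k::alg_closed_field poly"
  assumes "\<And>s. poly P s = poly Q s"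
  shows "P = Q"
proof (rule ccontr)
  assume "P \<noteq> Q"
  then have "finite {s. poly (P - Q) s = 0}"
    by (intro poly_roots_finite) simp
  then show False
    using assms infinite_alg_closed_field[where 'k = 'k] by simp
qed

definition curve :: "('v \<Rightarrow> 'k::field poly) \<Rightarrow> 'k \<Rightarrow> 'k ^ 'v::finite" where
  "curve c s = (\<chi> i. poly (c i) s)"

lemma curve_nth [simp]: "curve c s $ i = poly (c i) s"
  by (simp add: curve_def)

lemma polyfun_curve:
  assumes "polyfun f"
  obtains P where "\<And>s. f (curve c s) = poly P s"
proof -
  obtain p where f: "f = mpoly_eval p"
    using assms by (rule polyfunE)
  show ?thesis
    by (rule that[of "\<Sum>m\<in>Poly_Mapping.keys p. smult (Poly_Mapping.lookup p m)
            (\<Prod>i\<in>UNIV. c i ^ Poly_Mapping.lookup m i)"])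
       (simp add: f mpoly_eval_def mono_eval_def poly_sum poly_prod)
qed

lemma polymap_curve:
  assumes "polymap \<phi>"
  obtains c' where "\<And>s. \<phi> (curve c s) = curve c' s"
proof -
  have "\<exists>P. \<forall>s. \<phi> (curve c s) $ i = poly P s" for i
    using assms by (metis polymap_def polyfun_curve)
  then obtain c' where "\<And>i s. \<phi> (curve c s) $ i = poly (c' i) s"
    by metis
  then show ?thesis
    by (intro that[of c']) (simp add: vec_eq_iff)
qed

section \<open>Irreducible sets\<close>

text \<open>
  The ideal of polynomials vanishing on the set has the defining property of a prime ideal, except that it may
  be the whole ring. For a nonempty set this is irreducibility in the Zariski topology.
\<close>

definition prime_locus :: "('k::field ^ 'v::finite) set \<Rightarrow> bool" where
  "prime_locus Z \<longleftrightarrow> (\<forall>f g. polyfun f \<and> polyfun g \<and> (\<forall>x\<in>Z. f x * g x = 0) \<longrightarrow>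
     (\<forall>x\<in>Z. f x = 0) \<or> (\<forall>x\<in>Z. g x = 0))"

lemma closedin_subtopology_zariski_vanishing:
  assumes "polyfun f" shows "closedin (subtopology zariski X) (X \<inter> {x. f x = 0})"
  unfolding closedin_subtopology closedin_zariski_polyfun
  using assms by (intro exI[of _ "{x. f x = 0}"] conjI exI[of _ "{f}"]) auto

lemma irreducible_in_zariski_iff:
  "irreducible_in (subtopology zariski X) Z \<longleftrightarrow> Z \<subseteq> X \<and> Z \<noteq> {} \<and> prime_locus Z"
proof (intro iffI conjI)
  assume irr: "irreducible_in (subtopology zariski X) Z"
  then show "Z \<subseteq> X" "Z \<noteq> {}"
    by (auto simp: irreducible_in_def)
  show "prime_locus Z"
    unfolding prime_locus_def
  proof (intro allI impI)
    fix f g :: "('a, 'b) vec \<Rightarrow> 'a"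
    assume "polyfun f \<and> polyfun g \<and> (\<forall>x\<in>Z. f x * g x = 0)"
    then have *: "closedin (subtopology zariski X) (X \<inter> {x. f x = 0})"
      "closedin (subtopology zariski X) (X \<inter> {x. g x = 0})"
      "Z \<subseteq> (X \<inter> {x. f x = 0}) \<union> (X \<inter> {x. g x = 0})"
      using \<open>Z \<subseteq> X\<close> by (auto intro: closedin_subtopology_zariski_vanishing)
    then have "Z \<subseteq> X \<inter> {x. f x = 0} \<or> Z \<subseteq> X \<inter> {x. g x = 0}"
      using irr unfolding irreducible_in_def by blast
    then show "(\<forall>x\<in>Z. f x = 0) \<or> (\<forall>x\<in>Z. g x = 0)"
      by auto
  qed
next
  assume Z: "Z \<subseteq> X \<and> Z \<noteq> {} \<and> prime_locus Z"
  show "irreducible_in (subtopology zariski X) Z"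
    unfolding irreducible_in_def
  proof (intro conjI allI impI)
    fix A B
    assume AB: "closedin (subtopology zariski X) A \<and> closedin (subtopology zariski X) B \<and> Z \<subseteq> A \<union> B"
    obtain F where F: "\<forall>f\<in>F. polyfun f" "A = {x. \<forall>f\<in>F. f x = 0} \<inter> X"
      using AB by (auto simp: closedin_subtopology closedin_zariski_polyfun)
    obtain G where G: "\<forall>f\<in>G. polyfun f" "B = {x. \<forall>f\<in>G. f x = 0} \<inter> X"
      using AB by (auto simp: closedin_subtopology closedin_zariski_polyfun)
    show "Z \<subseteq> A \<or> Z \<subseteq> B"
    proof (rule ccontr)
      assume "\<not> (Z \<subseteq> A \<or> Z \<subseteq> B)"
      then obtain x y f g where xy: "x \<in> Z" "f \<in> F" "f x \<noteq> 0" "y \<in> Z" "g \<in> G" "g y \<noteq> 0"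
        using Z F G by blast
      have "\<forall>z\<in>Z. f z * g z = 0"
        using AB F(2) G(2) xy by auto
      then have "(\<forall>z\<in>Z. f z = 0) \<or> (\<forall>z\<in>Z. g z = 0)"
        using Z F(1) G(1) xy unfolding prime_locus_def by blast
      then show False
        using xy by blast
    qed
  qed (use Z in auto)
qed

text \<open>
  If \<open>f\<close> does not vanish at \<open>x\<close> and \<open>g\<close> does not vanish at
  \<open>y\<close>, restrict both to a polynomial curve through \<open>x\<close> and \<open>y\<close>. Both
  restrictions are nonzero polynomials in one variable, hence so is their product, and over an infinite field
  it has a nonzero value.
\<close>

lemma prime_locus_if_curve_connected:
  fixes Z :: "('k::alg_closed_field ^ 'v::finite) set"
  assumes "\<And>x y. x \<in> Z \<Longrightarrow> y \<in> Z \<Longrightarrow> \<exists>c. (\<forall>s. curve c s \<in> Z) \<and> curve c 0 = x \<and> curve c 1 = y"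
  shows "prime_locus Z"
  unfolding prime_locus_def
proof (intro allI impI, elim conjE)
  fix f g :: "'k ^ 'v \<Rightarrow> 'k"
  assume fg: "polyfun f" "polyfun g" and zero: "\<forall>x\<in>Z. f x * g x = 0"
  show "(\<forall>x\<in>Z. f x = 0) \<or> (\<forall>x\<in>Z. g x = 0)"
  proof (rule ccontr)
    assume "\<not> ((\<forall>x\<in>Z. f x = 0) \<or> (\<forall>x\<in>Z. g x = 0))"
    then obtain x y where xy: "x \<in> Z" "f x \<noteq> 0" "y \<in> Z" "g y \<noteq> 0"
      by blast
    obtain c where c: "\<forall>s. curve c s \<in> Z" "curve c 0 = x" "curve c 1 = y"
      using assms xy by blast
    obtain P where P: "\<And>s. f (curve c s) = poly P s"
      by (rule polyfun_curve[OF fg(1), where c = c]) (rule that)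
    obtain Q where Q: "\<And>s. g (curve c s) = poly Q s"
      by (rule polyfun_curve[OF fg(2), where c = c]) (rule that)
    have "poly (P * Q) s = poly 0 s" for s
      using zero c(1) by (metis P Q poly_0 poly_mult)
    then have "P = 0 \<or> Q = 0"
      by (metis poly_eqI_infinite mult_eq_0_iff)
    then show False
      using P[of 0] Q[of 1] c xy by auto
  qed
qed

text \<open>
  Affine spaces of all dimensions are realised as coordinate subspaces of one type, so that the dimension can
  vary within a statement.
\<close>

definition coordspace :: "'v set \<Rightarrow> ('k::field ^ 'v::finite) set" where
  "coordspace C = {x. \<forall>i. i \<notin> C \<longrightarrow> x $ i = 0}"

lemma zero_in_coordspace [simp]: "0 \<in> coordspace C"
  by (simp add: coordspace_def)

lemma coordspace_mono: "C \<subseteq> C' \<Longrightarrow> coordspace C \<subseteq> coordspace C'"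
  by (auto simp: coordspace_def)

lemma prime_locus_image_coordspace:
  fixes \<phi> :: "'k::alg_closed_field ^ 'u::finite \<Rightarrow> 'k ^ 'v::finite"
  assumes "polymap \<phi>"
  shows "prime_locus (\<phi> ` coordspace C)"
proof (rule prime_locus_if_curve_connected)
  fix x y assume "x \<in> \<phi> ` coordspace C" "y \<in> \<phi> ` coordspace C"
  then obtain a b where ab: "a \<in> coordspace C" "x = \<phi> a" "b \<in> coordspace C" "y = \<phi> b"
    by blast
  let ?l = "curve (\<lambda>i. [:a $ i, (b - a) $ i:])"
  have l: "?l s \<in> coordspace C" for s
    using ab by (simp add: coordspace_def)
  obtain c' where c': "\<And>s. \<phi> (?l s) = curve c' s"
    by (rule polymap_curve[OF assms, where c = "\<lambda>i. [:a $ i, (b - a) $ i:]"]) (rule that)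
  have "?l 0 = a" "?l 1 = b"
    by (simp_all add: vec_eq_iff)
  then show "\<exists>c. (\<forall>s. curve c s \<in> \<phi> ` coordspace C) \<and> curve c 0 = x \<and> curve c 1 = y"
    using l ab by (intro exI[of _ c'] conjI allI) (simp_all only: c'[symmetric] imageI)
qed

definition zclosure :: "('k::field ^ 'v::finite) set \<Rightarrow> ('k ^ 'v) set" where
  "zclosure D = zero_locus (vanishing_ideal D)"

lemma zclosure_subset: "D \<subseteq> zclosure D"
  by (auto simp: zclosure_def zero_locus_def vanishing_ideal_def)

lemma closedin_zclosure: "closedin zariski (zclosure D)"
  by (auto simp: closedin_zariski zclosure_def)

lemma polyfun_zero_on_zclosure:
  assumes "polyfun f" "\<And>x. x \<in> D \<Longrightarrow> f x = 0" "x \<in> zclosure D"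
  shows "f x = 0"
  using assms by (auto simp: zclosure_def zero_locus_def vanishing_ideal_def elim!: polyfunE)

lemma zclosure_mono: "D \<subseteq> E \<Longrightarrow> zclosure D \<subseteq> zclosure E"
  by (auto simp: zclosure_def zero_locus_def vanishing_ideal_def)

lemma prime_locus_between:
  assumes D: "prime_locus D" "D \<subseteq> Z" "Z \<subseteq> zclosure D"
  shows "prime_locus Z"
  unfolding prime_locus_def
proof (intro allI impI, elim conjE)
  fix f g assume fg: "polyfun f" "polyfun g" "\<forall>x\<in>Z. f x * g x = 0"
  then have "(\<forall>x\<in>D. f x = 0) \<or> (\<forall>x\<in>D. g x = 0)"
    using D unfolding prime_locus_def by blast
  then show "(\<forall>x\<in>Z. f x = 0) \<or> (\<forall>x\<in>Z. g x = 0)"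
    using polyfun_zero_on_zclosure[OF fg(1)] polyfun_zero_on_zclosure[OF fg(2)] D(3) by blast
qed

section \<open>Dimension of parametrised sets\<close>

text \<open>
  A homogeneous linear system with more unknowns than equations has a nontrivial solution. Gaussian
  elimination: solve equation \<open>j\<close> for an unknown \<open>r\<close> that occurs in it and
  substitute.
\<close>

lemma nontrivial_solution:
  fixes a :: "'i \<Rightarrow> 'j \<Rightarrow> 'k::field"
  assumes "finite J" "finite I" "card J < card I"
  shows "\<exists>c. (\<exists>i\<in>I. c i \<noteq> 0) \<and> (\<forall>j\<in>J. (\<Sum>i\<in>I. c i * a i j) = 0)"
  using assms
proof (induction J arbitrary: I a rule: finite_induct)
  case empty
  then have "\<exists>i. i \<in> I"
    by (auto simp: card_gt_0_iff)
  then show ?case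
    by (intro exI[of _ "\<lambda>i. 1"]) auto
next
  case (insert j J)
  show ?case
  proof (cases "\<forall>i\<in>I. a i j = 0")
    case True
    obtain c where "\<exists>i\<in>I. c i \<noteq> 0" "\<forall>l\<in>J. (\<Sum>i\<in>I. c i * a i l) = 0"
      using insert.IH[of I a] insert.prems insert.hyps by auto
    with True show ?thesis
      by (intro exI[of _ c]) auto
  next
    case False
    then obtain r where r: "r \<in> I" "a r j \<noteq> 0"
      by blast
    define I' where "I' = I - {r}"
    have I': "I = insert r I'" "r \<notin> I'" "finite I'"
      using r insert.prems by (auto simp: I'_def)
    have "card J < card I'"
      using I' insert.prems insert.hyps by auto
    then obtain c where c: "\<exists>i\<in>I'. c i \<noteq> 0"
      "\<forall>l\<in>J. (\<Sum>i\<in>I'. c i * (a i l - a i j / a r j * a r l)) = 0"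
      using insert.IH[of I' "\<lambda>i l. a i l - a i j / a r j * a r l"] I' by auto
    define c' where "c' = (\<lambda>i. if i = r then - (\<Sum>i\<in>I'. c i * a i j) / a r j else c i)"
    have c': "(\<Sum>i\<in>I. c' i * a i l) = - (\<Sum>i\<in>I'. c i * a i j) / a r j * a r l + (\<Sum>i\<in>I'. c i * a i l)" for l
    proof -
      have "(\<Sum>i\<in>I'. c' i * a i l) = (\<Sum>i\<in>I'. c i * a i l)"
        using I' by (intro sum.cong) (auto simp: c'_def)
      then show ?thesis
        using I' by (simp add: c'_def)
    qed
    show ?thesis
    proof (intro exI[of _ c'] conjI ballI)
      show "\<exists>i\<in>I. c' i \<noteq> 0"
        using c(1) I' by (auto simp: c'_def)
    next
      fix l assume "l \<in> insert j J"
      then consider "l = j" | "l \<in> J"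
        by blast
      then show "(\<Sum>i\<in>I. c' i * a i l) = 0"
      proof cases
        case 1
        then show ?thesis
          using r by (simp add: c')
      next
        case 2
        have "0 = (\<Sum>i\<in>I'. c i * (a i l - a i j / a r j * a r l))"
          using c(2) 2 by simp
        also have "\<dots> = (\<Sum>i\<in>I'. c i * a i l - (c i * a i j) * (a r l / a r j))"
          by (intro sum.cong) (auto simp: field_simps)
        also have "\<dots> = (\<Sum>i\<in>I'. c i * a i l) - (\<Sum>i\<in>I'. c i * a i j) * (a r l / a r j)"
          by (simp add: sum_subtractf sum_distrib_right sum_divide_distrib)
        finally show ?thesis
          by (simp add: c')
      qed
    qed
  qed
qed

text \<open>
  The \<open>p i\<close> are algebraically independent on \<open>Z n\<close>; the relation is indexed by a set
  \<open>S\<close> of exponents that are told apart by their first \<open>n\<close> entries. In a relation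
  that holds on the largest set, the lowest power of the last polynomial can be cancelled because that set is
  irreducible. On the next smaller set the last polynomial vanishes, and what remains is a nontrivial relation
  between the other ones.
\<close>

lemma chain_independent:
  fixes Z :: "nat \<Rightarrow> ('k::field ^ 'v::finite) set" and c :: "(nat \<Rightarrow> nat) \<Rightarrow> 'k"
  assumes "\<forall>i\<le>n. prime_locus (Z i) \<and> Z i \<noteq> {}"
    and "\<forall>i<n. Z i \<subseteq> Z (Suc i)"
    and "\<forall>i<n. polyfun (p i) \<and> (\<forall>x\<in>Z i. p i x = 0) \<and> (\<exists>x\<in>Z (Suc i). p i x \<noteq> 0)"
    and "finite S" "S \<noteq> {}" "\<forall>k\<in>S. c k \<noteq> 0"
    and "\<forall>k\<in>S. \<forall>k'\<in>S. (\<forall>i<n. k i = k' i) \<longrightarrow> k = k'"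
  shows "\<exists>x\<in>Z n. (\<Sum>k\<in>S. c k * (\<Prod>i<n. p i x ^ k i)) \<noteq> 0"
  using assms
proof (induction n arbitrary: S)
  case 0
  then obtain k where "S = {k}"
    by auto
  then show ?case
    using 0 by auto
next
  case (Suc n)
  define e where "e = Min ((\<lambda>k. k n) ` S)"
  define S' where "S' = {k \<in> S. k n = e}"
  have e_le: "e \<le> k n" if "k \<in> S" for k
    using that Suc.prems by (simp add: e_def)
  have "e \<in> (\<lambda>k. k n) ` S"
    unfolding e_def using Suc.prems by (intro Min_in) auto
  then have S': "S' \<noteq> {}" "finite S'" "S' \<subseteq> S"
    using Suc.prems by (auto simp: S'_def)
  have "\<exists>x\<in>Z n. (\<Sum>k\<in>S'. c k * (\<Prod>i<n. p i x ^ k i)) \<noteq> 0"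
  proof (rule Suc.IH)
    show "\<forall>k\<in>S'. \<forall>k'\<in>S'. (\<forall>i<n. k i = k' i) \<longrightarrow> k = k'"
      using Suc.prems(7) by (auto simp: S'_def less_Suc_eq)
    show "\<forall>i\<le>n. prime_locus (Z i) \<and> Z i \<noteq> {}" "\<forall>i<n. Z i \<subseteq> Z (Suc i)"
      "\<forall>i<n. polyfun (p i) \<and> (\<forall>x\<in>Z i. p i x = 0) \<and> (\<exists>x\<in>Z (Suc i). p i x \<noteq> 0)"
      using Suc.prems(1,2,3) le_SucI less_SucI by metis+
    show "finite S'" "S' \<noteq> {}" "\<forall>k\<in>S'. c k \<noteq> 0"
      using S' Suc.prems(6) by blast+
  qed
  then obtain x where x: "x \<in> Z n" "(\<Sum>k\<in>S'. c k * (\<Prod>i<n. p i x ^ k i)) \<noteq> 0"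
    by blast
  show ?case
  proof (rule ccontr)
    assume contra: "\<not> ?case"
    (* the relation with the factor p n ^ e cancelled *)
    define g where "g = (\<lambda>x. \<Sum>k\<in>S. c k * (\<Prod>i<n. p i x ^ k i) * p n x ^ (k n - e))"
    have "p n y ^ e * g y = (\<Sum>k\<in>S. c k * (\<Prod>i<Suc n. p i y ^ k i))" for y
      unfolding g_def sum_distrib_left
      by (rule sum.cong) (auto simp: e_le mult_ac simp flip: power_add)
    then have zero: "\<forall>y\<in>Z (Suc n). p n y ^ e * g y = 0"
      using contra by auto
    have "polyfun g"
      unfolding g_def using Suc.prems(3)
      by (intro polyfun_sum polyfun_mult polyfun_prod polyfun_const polyfun_power) auto
    then have "(\<forall>y\<in>Z (Suc n). p n y ^ e = 0) \<or> (\<forall>y\<in>Z (Suc n). g y = 0)"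
      using zero Suc.prems(1,3) polyfun_power[of "p n" e] unfolding prime_locus_def by blast
    moreover have "\<not> (\<forall>y\<in>Z (Suc n). p n y ^ e = 0)"
      using Suc.prems(3) by auto
    ultimately have "g x = 0"
      using x Suc.prems(2) by auto
    moreover have "g x = (\<Sum>k\<in>S'. c k * (\<Prod>i<n. p i x ^ k i))"
    proof -
      have "p n x = 0"
        using x Suc.prems(3) by auto
      then have "g x = (\<Sum>k\<in>S. if k n = e then c k * (\<Prod>i<n. p i x ^ k i) else 0)"
        unfolding g_def using e_le by (intro sum.cong) (fastforce simp: power_0_left)+
      also have "\<dots> = (\<Sum>k\<in>S'. c k * (\<Prod>i<n. p i x ^ k i))"
        unfolding S'_def using Suc.prems(4) by (simp add: sum.inter_filter)
      finally show ?thesis .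
    qed
    ultimately show False
      using x by simp
  qed
qed

text \<open>
  The degree is bounded separately in each variable: the monomials with bounded exponents form a box, whose
  cardinality is a plain power.
\<close>

definition exponents_le :: "nat \<Rightarrow> ('v, 'k::field) mpoly \<Rightarrow> bool" where
  "exponents_le e p \<longleftrightarrow> (\<forall>m\<in>Poly_Mapping.keys p. \<forall>i. Poly_Mapping.lookup m i \<le> e)"

lemma ex_exponents_le:
  fixes p :: "('v::finite, 'k::field) mpoly"
  shows "\<exists>e. exponents_le e p"
proof (intro exI)
  show "exponents_le (\<Sum>m\<in>Poly_Mapping.keys p. \<Sum>i\<in>UNIV. Poly_Mapping.lookup m i) p"
    unfolding exponents_le_def
  proof (intro ballI allI)
    fix m i assume m: "m \<in> Poly_Mapping.keys p"
    have "Poly_Mapping.lookup m i \<le> (\<Sum>i\<in>UNIV. Poly_Mapping.lookup m i)"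
      by (rule member_le_sum) auto
    also have "\<dots> \<le> (\<Sum>m\<in>Poly_Mapping.keys p. \<Sum>i\<in>UNIV. Poly_Mapping.lookup m i)"
      using m by (intro member_le_sum[where f = "\<lambda>m. \<Sum>i\<in>UNIV. Poly_Mapping.lookup m i"]) auto
    finally show "Poly_Mapping.lookup m i \<le> \<dots>" .
  qed
qed

lemma exponents_le_mono: "exponents_le e p \<Longrightarrow> e \<le> e' \<Longrightarrow> exponents_le e' p"
  unfolding exponents_le_def by (meson le_trans)

lemma exponents_le_1: "exponents_le 0 (1 :: ('v, 'k::field) mpoly)"
  by (simp add: exponents_le_def)

lemma exponents_le_mult:
  fixes p q :: "('v, 'k::field) mpoly"
  assumes "exponents_le e p" "exponents_le e' q"
  shows "exponents_le (e + e') (p * q)"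
  unfolding exponents_le_def
proof (intro ballI allI)
  fix m i assume "m \<in> Poly_Mapping.keys (p * q)"
  then obtain a b where "m = a + b" "a \<in> Poly_Mapping.keys p" "b \<in> Poly_Mapping.keys q"
    using keys_mult[of p q] by auto
  then show "Poly_Mapping.lookup m i \<le> e + e'"
    using assms by (auto simp: exponents_le_def lookup_add intro!: add_mono)
qed

lemma exponents_le_power:
  "exponents_le e p \<Longrightarrow> exponents_le (n * e) (p ^ n)"
  by (induction n) (auto intro: exponents_le_1 exponents_le_mult)

lemma exponents_le_prod:
  "(\<And>a. a \<in> A \<Longrightarrow> exponents_le e (f a)) \<Longrightarrow> finite A \<Longrightarrow> exponents_le (card A * e) (prod f A)"
  by (induction A rule: infinite_finite_induct) (auto intro: exponents_le_1 exponents_le_mult)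

definition box_monomials :: "'v set \<Rightarrow> nat \<Rightarrow> ('v \<Rightarrow>\<^sub>0 nat) set" where
  "box_monomials C e = {m. \<forall>i. Poly_Mapping.lookup m i \<le> (if i \<in> C then e else 0)}"

lemma
  fixes C :: "'v::finite set"
  shows finite_box_monomials: "finite (box_monomials C e)"
    and card_box_monomials: "card (box_monomials C e) \<le> (e + 1) ^ card C"
proof -
  let ?P = "PiE UNIV (\<lambda>i. {..if i \<in> C then e else 0})"
  have inj: "inj_on Poly_Mapping.lookup (box_monomials C e)"
    by (auto intro!: inj_onI poly_mapping_eqI)
  have sub: "Poly_Mapping.lookup ` box_monomials C e \<subseteq> ?P"
    by (auto simp: box_monomials_def)
  have fin: "finite ?P"
    by (intro finite_PiE) auto
  show "finite (box_monomials C e)"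
    using finite_subset[OF sub fin] inj by (rule finite_imageD)
  have "card (box_monomials C e) \<le> card ?P"
    using inj sub fin by (rule card_inj_on_le)
  also have "\<dots> = (\<Prod>i\<in>UNIV. if i \<in> C then e + 1 else 1)"
    by (subst card_PiE) (auto intro!: prod.cong)
  also have "\<dots> = (e + 1) ^ card C"
    by (simp add: prod.If_cases)
  finally show "card (box_monomials C e) \<le> (e + 1) ^ card C" .
qed

lemma mpoly_eval_coordspace:
  assumes "exponents_le e p" "x \<in> coordspace C"
  shows "mpoly_eval p x = (\<Sum>m\<in>box_monomials C e. Poly_Mapping.lookup p m * mono_eval m x)"
proof -
  have "mono_eval m x = 0" if m: "m \<in> Poly_Mapping.keys p - box_monomials C e" for m
  proof -
    obtain i where i: "\<not> Poly_Mapping.lookup m i \<le> (if i \<in> C then e else 0)"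
      using m by (auto simp: box_monomials_def)
    then have "i \<notin> C"
      using m assms(1) by (auto simp: exponents_le_def split: if_splits)
    then have "x $ i ^ Poly_Mapping.lookup m i = 0"
      using i assms(2) by (auto simp: coordspace_def)
    then show ?thesis
      unfolding mono_eval_def by (intro prod_zero) auto
  qed
  then have "mpoly_eval p x =
      (\<Sum>m\<in>Poly_Mapping.keys p \<inter> box_monomials C e. Poly_Mapping.lookup p m * mono_eval m x)"
    unfolding mpoly_eval_def by (intro sum.mono_neutral_right) auto
  also have "\<dots> = (\<Sum>m\<in>box_monomials C e. Poly_Mapping.lookup p m * mono_eval m x)"
    using finite_box_monomials by (intro sum.mono_neutral_left) (auto simp: in_keys_iff)
  finally show ?thesis .
qed

text \<open>
  Let \<open>d = card C\<close> and \<open>n > d\<close>. The products of the \<open>n\<close> independent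
  polynomials with exponents below \<open>D\<close> number \<open>D ^ n\<close>. Pulled back along
  \<open>\<phi>\<close> they lie in the span of \<open>O(D ^ d)\<close> monomials, so they are linearly
  dependent for large \<open>D\<close>, and the dependence holds on the whole closure of the image.
\<close>

lemma chain_length_le:
  fixes \<phi> :: "'k::field ^ 'u::finite \<Rightarrow> 'k ^ 'v::finite" and Z :: "nat \<Rightarrow> ('k ^ 'v) set"
  assumes \<phi>: "polymap \<phi>" and Z_top: "Z n \<subseteq> zclosure (\<phi> ` coordspace C)"
    and prime: "\<forall>i\<le>n. prime_locus (Z i) \<and> Z i \<noteq> {}"
    and mono: "\<forall>i<n. Z i \<subseteq> Z (Suc i)"
    and p: "\<forall>i<n. polyfun (p i) \<and> (\<forall>x\<in>Z i. p i x = 0) \<and> (\<exists>x\<in>Z (Suc i). p i x \<noteq> 0)"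
  shows "n \<le> card C"
proof (rule ccontr)
  assume "\<not> n \<le> card C"
  then have n: "card C + 1 \<le> n"
    by simp
  have "\<exists>q. \<forall>s. p i (\<phi> s) = mpoly_eval q s" if "i < n" for i
    using polyfun_compose[of "p i" \<phi>] \<phi> p that by (auto elim!: polyfunE simp: fun_eq_iff)
  then obtain q where q: "\<And>i s. i < n \<Longrightarrow> p i (\<phi> s) = mpoly_eval (q i) s"
    by metis
  obtain e' where e': "\<And>i. exponents_le (e' i) (q i)"
    using ex_exponents_le[of "q i" for i] by metis
  define e where "e = (\<Sum>i<n. e' i)"
  have e: "exponents_le e (q i)" if "i < n" for i
    using e'[of i] by (rule exponents_le_mono) (use that in \<open>auto simp: e_def intro!: member_le_sum\<close>)
  (* any D > (n * e + 1) ^ card C makes the count of monomials below smaller than D ^ n *)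
  define D where "D = (n * e + 1) ^ card C + 1"
  define E where "E = n * (D * e)"
  define I where "I = PiE {..<n} (\<lambda>_. {..<D})"
  define q' where "q' = (\<lambda>k. \<Prod>i<n. q i ^ k i)"
  have q': "exponents_le E (q' k)" if "k \<in> I" for k
  proof -
    have "exponents_le (D * e) (q i ^ k i)" if "i \<in> {..<n}" for i
    proof (rule exponents_le_mono[OF exponents_le_power[OF e]])
      show "k i * e \<le> D * e"
        using \<open>k \<in> I\<close> that by (intro mult_right_mono) (auto simp: I_def PiE_iff less_imp_le)
    qed (use that in auto)
    then show ?thesis
      unfolding q'_def E_def using exponents_le_prod[of "{..<n}" "D * e" "\<lambda>i. q i ^ k i"] by simp
  qed
  have "card (box_monomials C E) \<le> (E + 1) ^ card C"
    by (rule card_box_monomials)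
  also have "\<dots> \<le> ((n * e + 1) * D) ^ card C"
    by (intro power_mono) (auto simp: E_def D_def algebra_simps)
  also have "\<dots> < D * D ^ card C"
  proof -
    have "(n * e + 1) ^ card C < D" "0 < D ^ card C"
      by (simp_all add: D_def)
    then show ?thesis
      by (simp only: power_mult_distrib mult_less_cancel2)
  qed
  also have "\<dots> \<le> D ^ n"
    using power_increasing[OF n, of D] by (simp add: D_def)
  finally have "card (box_monomials C E) < card I"
    by (simp add: I_def card_PiE)
  then obtain c where c: "\<exists>k\<in>I. c k \<noteq> 0"
    "\<forall>m\<in>box_monomials C E. (\<Sum>k\<in>I. c k * Poly_Mapping.lookup (q' k) m) = 0"
    using nontrivial_solution[OF finite_box_monomials, of I C E "\<lambda>k. Poly_Mapping.lookup (q' k)"]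
    by (auto simp: I_def finite_PiE)
  define S where "S = {k \<in> I. c k \<noteq> 0}"
  define f where "f = (\<lambda>x. \<Sum>k\<in>S. c k * (\<Prod>i<n. p i x ^ k i))"
  have "f (\<phi> s) = 0" if s: "s \<in> coordspace C" for s
  proof -
    have "f (\<phi> s) = (\<Sum>k\<in>S. c k * mpoly_eval (q' k) s)"
      unfolding f_def q'_def by (intro sum.cong) (auto simp: mpoly_eval_prod mpoly_eval_power q)
    also have "\<dots> = (\<Sum>k\<in>I. c k * mpoly_eval (q' k) s)"
      by (intro sum.mono_neutral_left) (auto simp: S_def I_def finite_PiE)
    also have "\<dots> = (\<Sum>k\<in>I. \<Sum>m\<in>box_monomials C E. c k * Poly_Mapping.lookup (q' k) m * mono_eval m s)"
      by (intro sum.cong) (auto simp: mpoly_eval_coordspace[OF q' s] sum_distrib_left mult_ac)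
    also have "\<dots> = (\<Sum>m\<in>box_monomials C E. \<Sum>k\<in>I. c k * Poly_Mapping.lookup (q' k) m * mono_eval m s)"
      by (rule sum.swap)
    also have "\<dots> = 0"
      using c(2) by (intro sum.neutral) (simp flip: sum_distrib_right)
    finally show ?thesis .
  qed
  moreover have "polyfun f"
    unfolding f_def using p by (intro polyfun_sum polyfun_mult polyfun_prod polyfun_const polyfun_power) auto
  ultimately have "\<forall>x\<in>Z n. f x = 0"
    using Z_top polyfun_zero_on_zclosure[of f "\<phi> ` coordspace C"] by blast
  moreover have "\<exists>x\<in>Z n. f x \<noteq> 0"
    unfolding f_def
  proof (rule chain_independent[OF prime mono p])
    show "finite S" "S \<noteq> {}" "\<forall>k\<in>S. c k \<noteq> 0"
      using c(1) by (auto simp: S_def I_def finite_PiE)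
    show "\<forall>k\<in>S. \<forall>k'\<in>S. (\<forall>i<n. k i = k' i) \<longrightarrow> k = k'"
      by (auto simp: S_def I_def intro: PiE_ext)
  qed
  ultimately show False
    by blast
qed

lemma closed_subset_separated:
  assumes "closedin (subtopology zariski X) Z" "Z \<subset> Z'" "Z' \<subseteq> X"
  obtains f where "polyfun f" "\<forall>x\<in>Z. f x = 0" "\<exists>x\<in>Z'. f x \<noteq> 0"
proof -
  obtain F where F: "\<forall>f\<in>F. polyfun f" "Z = {x. \<forall>f\<in>F. f x = 0} \<inter> X"
    using assms(1) by (auto simp: closedin_subtopology closedin_zariski_polyfun)
  obtain x where x: "x \<in> Z'" "x \<notin> Z"
    using assms(2) by blast
  then obtain f where f: "f \<in> F" "f x \<noteq> 0"
    using F(2) assms(3) by auto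
  show ?thesis
    by (rule that[of f]) (use F f x in auto)
qed

text \<open>
  The lower bound comes from the flag of coordinate subspaces that \<open>e\<close> enumerates: the closures
  of their images are irreducible, and \<open>g k\<close> is there to certify that step \<open>k\<close> of
  the resulting chain is strict. A separate certificate is needed because \<open>\<phi>\<close> may collapse
  subspaces.
\<close>

lemma variety_dim_parametrised:
  fixes \<phi> :: "'k::alg_closed_field ^ 'u::finite \<Rightarrow> 'k ^ 'v::finite"
  assumes \<phi>: "polymap \<phi>" and sub: "\<phi> ` coordspace C \<subseteq> X" and dense: "X \<subseteq> zclosure (\<phi> ` coordspace C)"
    and e: "bij_betw e {..<card C} C"
    and g: "\<And>k. k < card C \<Longrightarrow> polyfun (g k)"
      "\<And>k s. k < card C \<Longrightarrow> s \<in> coordspace (e ` {..<k}) \<Longrightarrow> g k (\<phi> s) = 0"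
      "\<And>k. k < card C \<Longrightarrow> \<exists>s\<in>coordspace (e ` {..<Suc k}). g k (\<phi> s) \<noteq> 0"
  shows "variety_dim X = enat (card C)"
  unfolding variety_dim_def krull_dim_def
proof (rule antisym)
  show "Sup {enat n |n. \<exists>Z. (\<forall>i\<le>n. closedin (subtopology zariski X) (Z i) \<and>
      irreducible_in (subtopology zariski X) (Z i)) \<and> (\<forall>i<n. Z i \<subset> Z (Suc i))} \<le> enat (card C)"
  proof (rule Sup_least, elim CollectE exE conjE)
    fix m n and Z :: "nat \<Rightarrow> ('k ^ 'v) set"
    assume m: "m = enat n"
      and Z: "\<forall>i\<le>n. closedin (subtopology zariski X) (Z i) \<and> irreducible_in (subtopology zariski X) (Z i)"
        "\<forall>i<n. Z i \<subset> Z (Suc i)"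
    have irr: "\<forall>i\<le>n. prime_locus (Z i) \<and> Z i \<noteq> {}" "\<forall>i\<le>n. Z i \<subseteq> X"
      using Z by (auto simp: irreducible_in_zariski_iff)
    have "\<exists>f. polyfun f \<and> (\<forall>x\<in>Z i. f x = 0) \<and> (\<exists>x\<in>Z (Suc i). f x \<noteq> 0)" if "i < n" for i
      by (rule closed_subset_separated[of X "Z i" "Z (Suc i)"]) (use that Z irr in auto)
    then obtain p where p: "\<forall>i<n. polyfun (p i) \<and> (\<forall>x\<in>Z i. p i x = 0) \<and> (\<exists>x\<in>Z (Suc i). p i x \<noteq> 0)"
      by metis
    have "n \<le> card C"
    proof (rule chain_length_le[OF \<phi> _ irr(1) _ p])
      show "Z n \<subseteq> zclosure (\<phi> ` coordspace C)"
        using irr(2) dense by (meson order_refl subset_trans)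
      show "\<forall>i<n. Z i \<subseteq> Z (Suc i)"
        using Z(2) by (simp add: psubset_imp_subset)
    qed
    then show "m \<le> enat (card C)"
      by (simp add: m)
  qed
next
  define Z where "Z = (\<lambda>k. X \<inter> zclosure (\<phi> ` coordspace (e ` {..<k})))"
  have "\<forall>i\<le>card C. closedin (subtopology zariski X) (Z i) \<and> irreducible_in (subtopology zariski X) (Z i)"
  proof (intro allI impI conjI)
    fix i assume i: "i \<le> card C"
    show "closedin (subtopology zariski X) (Z i)"
      unfolding closedin_subtopology Z_def using closedin_zclosure by blast
    have "e ` {..<i} \<subseteq> C"
      using e i by (auto simp: bij_betw_def)
    then have D: "\<phi> ` coordspace (e ` {..<i}) \<subseteq> Z i"
      using sub coordspace_mono[of "e ` {..<i}" C] zclosure_subset by (fastforce simp: Z_def)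
    have "prime_locus (Z i)"
      by (rule prime_locus_between[OF prime_locus_image_coordspace[OF \<phi>] D]) (auto simp: Z_def)
    moreover have "Z i \<noteq> {}"
      using D zero_in_coordspace by blast
    ultimately show "irreducible_in (subtopology zariski X) (Z i)"
      by (simp add: irreducible_in_zariski_iff Z_def)
  qed
  moreover have "\<forall>i<card C. Z i \<subset> Z (Suc i)"
  proof (intro allI impI psubsetI)
    fix i assume i: "i < card C"
    have "coordspace (e ` {..<i}) \<subseteq> (coordspace (e ` {..<Suc i}) :: ('k ^ 'u) set)"
      by (intro coordspace_mono) auto
    then show "Z i \<subseteq> Z (Suc i)"
      unfolding Z_def by (intro Int_mono zclosure_mono image_mono) auto
    obtain s where s: "s \<in> coordspace (e ` {..<Suc i})" "g i (\<phi> s) \<noteq> 0"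
      using g(3) i by blast
    have "e ` {..<Suc i} \<subseteq> C"
      using e i by (auto simp: bij_betw_def)
    then have "\<phi> s \<in> Z (Suc i)"
      using s sub coordspace_mono[of "e ` {..<Suc i}" C] zclosure_subset by (fastforce simp: Z_def)
    moreover have "\<phi> s \<notin> Z i"
      using s(2) g(1,2)[OF i] polyfun_zero_on_zclosure[of "g i" "\<phi> ` coordspace (e ` {..<i})" "\<phi> s"]
      by (auto simp: Z_def)
    ultimately show "Z i \<noteq> Z (Suc i)"
      by blast
  qed
  ultimately show "enat (card C) \<le> Sup {enat n |n. \<exists>Z. (\<forall>i\<le>n. closedin (subtopology zariski X) (Z i) \<and>
      irreducible_in (subtopology zariski X) (Z i)) \<and> (\<forall>i<n. Z i \<subset> Z (Suc i))}"
    by (intro Sup_upper CollectI exI[of _ "card C"] exI[of _ Z]) auto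
qed

lemma local_dim_irreducible:
  assumes "prime_locus X" "x \<in> X"
  shows "local_dim X x = variety_dim X"
proof -
  have irr: "irreducible_in (subtopology zariski X) X"
    using assms by (auto simp: irreducible_in_zariski_iff)
  have "irreducible_component (subtopology zariski X) Z \<longleftrightarrow> Z = X" for Z
    using irr by (auto simp: irreducible_component_def irreducible_in_zariski_iff)
  then have "{variety_dim Z | Z. irreducible_component (subtopology zariski X) Z \<and> x \<in> Z} = {variety_dim X}"
    using assms by auto
  then show ?thesis
    by (simp add: local_dim_def)
qed

section \<open>Tangent vectors as velocities of curves\<close>

text \<open>
  The chain rule for the formal partial derivatives. Since the field is infinite, \<open>Q\<close> is the
  composition of \<open>p\<close> with \<open>c\<close> as a polynomial, so tangent vectors can be computed by
  expanding in one variable: a curve inside \<open>X\<close> has \<open>Q = 0\<close> and its velocity is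
  tangent, and conversely expanding an equation of \<open>X\<close> along a line in a tangent direction gives
  a linear condition on that direction.
\<close>

lemma derivative_along_curve:
  fixes p :: "('v::finite, 'k::alg_closed_field) mpoly"
  assumes "\<And>s. mpoly_eval p (curve c s) = poly Q s"
  shows "(\<Sum>i\<in>UNIV. mpoly_eval (mpoly_pderiv i p) (curve c 0) * poly (pderiv (c i)) 0) = poly (pderiv Q) 0"
proof -
  let ?K = "Poly_Mapping.keys p" and ?l = "Poly_Mapping.lookup"
  have Q: "Q = (\<Sum>m\<in>?K. smult (?l p m) (\<Prod>i\<in>UNIV. c i ^ ?l m i))"
    by (rule poly_eqI_infinite)
       (simp add: assms[symmetric] mpoly_eval_def mono_eval_def poly_sum poly_prod)
  have mono: "mono_eval (m - Poly_Mapping.single i 1) x = x $ i ^ (?l m i - 1) * (\<Prod>j\<in>UNIV - {i}. x $ j ^ ?l m j)"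
    for m i and x :: "'k ^ 'v"
  proof -
    have "(\<Prod>j\<in>UNIV - {i}. x $ j ^ ?l (m - Poly_Mapping.single i 1) j) = (\<Prod>j\<in>UNIV - {i}. x $ j ^ ?l m j)"
      by (rule prod.cong) (auto simp: lookup_minus lookup_single)
    then show ?thesis
      unfolding mono_eval_def by (subst prod.remove[of UNIV i]) (simp_all add: lookup_minus)
  qed
  have "poly (pderiv Q) 0 = (\<Sum>m\<in>?K. \<Sum>i\<in>UNIV. of_nat (?l m i) * ?l p m *
      mono_eval (m - Poly_Mapping.single i 1) (curve c 0) * poly (pderiv (c i)) 0)"
    unfolding Q higher_pderiv_sum[of 1, simplified] pderiv_smult pderiv_prod pderiv_power poly_sum poly_smult sum_distrib_left
    by (intro sum.cong refl) (simp only: mono poly_prod poly_mult poly_smult poly_power curve_nth mult_ac)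
  also have "\<dots> = (\<Sum>i\<in>UNIV. \<Sum>m\<in>?K. of_nat (?l m i) * ?l p m *
      mono_eval (m - Poly_Mapping.single i 1) (curve c 0) * poly (pderiv (c i)) 0)"
    by (rule sum.swap)
  also have "\<dots> = (\<Sum>i\<in>UNIV. mpoly_eval (mpoly_pderiv i p) (curve c 0) * poly (pderiv (c i)) 0)"
    by (simp add: mpoly_pderiv_def mpoly_eval_sum mpoly_eval_single sum_distrib_right)
  finally show ?thesis ..
qed

lemma velocity_in_tangent_space:
  fixes X :: "('k::alg_closed_field ^ 'v::finite) set"
  assumes "\<And>s. curve c s \<in> X"
  shows "(\<chi> i. poly (pderiv (c i)) 0) \<in> tangent_space X (curve c 0)"
  unfolding tangent_space_def
proof (rule CollectI, rule ballI)
  fix p assume "p \<in> vanishing_ideal X"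
  then have "mpoly_eval p (curve c s) = poly 0 s" for s
    using assms by (simp add: vanishing_ideal_def)
  then show "(\<Sum>i\<in>UNIV. mpoly_eval (mpoly_pderiv i p) (curve c 0) * (\<chi> i. poly (pderiv (c i)) 0) $ i) = 0"
    using derivative_along_curve[of p c 0] by simp
qed

lemma tangent_space_equation:
  fixes X :: "('k::alg_closed_field ^ 'v::finite) set"
  assumes w: "w \<in> tangent_space X x" and f: "polyfun f" "\<And>x. x \<in> X \<Longrightarrow> f x = 0"
    and Q: "\<And>s. f (x + s *s w) = poly Q s"
  shows "poly (pderiv Q) 0 = 0"
proof -
  obtain p where p: "f = mpoly_eval p"
    using f(1) by (rule polyfunE)
  define c where "c = (\<lambda>i. [:x $ i, w $ i:])"
  have c: "curve c s = x + s *s w" for s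
    by (simp add: c_def vec_eq_iff)
  have "p \<in> vanishing_ideal X"
    using f(2) by (simp add: vanishing_ideal_def p)
  then have "(\<Sum>i\<in>UNIV. mpoly_eval (mpoly_pderiv i p) x * w $ i) = 0"
    using w by (simp add: tangent_space_def)
  moreover have "(\<Sum>i\<in>UNIV. mpoly_eval (mpoly_pderiv i p) x * w $ i) = poly (pderiv Q) 0"
    using derivative_along_curve[of p c Q] Q by (simp add: c p) (simp add: c_def pderiv_pCons)
  ultimately show ?thesis
    by simp
qed

lemma subspace_tangent_space: "vec.subspace (tangent_space X x)"
  unfolding vec.subspace_def tangent_space_def
  by (auto simp: distrib_left sum.distrib mult.left_commute simp flip: sum_distrib_left)

section \<open>Coordinates on subspaces\<close>

definition restrict_coords :: "('u \<Rightarrow> 'v) \<Rightarrow> 'u set \<Rightarrow> 'k::field ^ 'v::finite \<Rightarrow> 'k ^ 'u::finite" where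
  "restrict_coords \<rho> C w = (\<chi> c. if c \<in> C then w $ \<rho> c else 0)"

lemma linear_restrict_coords: "Vector_Spaces.linear (*s) (*s) (restrict_coords \<rho> C)"
  by unfold_locales (auto simp: restrict_coords_def vec_eq_iff algebra_simps)

text \<open>
  The hypotheses make the projection onto the coordinates \<open>\<rho> ` C\<close> an isomorphism from
  \<open>W\<close> to a coordinate space. The map \<open>\<rho>\<close> is there for subspaces whose free
  coordinates are indexed by another type than their parameters, such as the tangent spaces of the Nash
  blowup.
\<close>

lemma dim_eq_card_coords:
  assumes W: "vec.subspace W"
    and inj: "\<And>w. w \<in> W \<Longrightarrow> (\<And>c. c \<in> C \<Longrightarrow> w $ \<rho> c = 0) \<Longrightarrow> w = 0"
    and surj: "\<And>s. s \<in> coordspace C \<Longrightarrow> \<exists>w\<in>W. \<forall>c\<in>C. w $ \<rho> c = s $ c"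
  shows "vec.dim W = card C"
proof -
  let ?R = "restrict_coords \<rho> C :: 'a ^ 'b \<Rightarrow> 'a ^ 'c"
  have "inj_on ?R W"
  proof (rule inj_onI)
    fix v w assume vw: "v \<in> W" "w \<in> W" "?R v = ?R w"
    have "v - w = 0"
    proof (rule inj)
      show "v - w \<in> W"
        using W vw by (simp add: vec.subspace_diff)
      fix c assume "c \<in> C"
      then show "(v - w) $ \<rho> c = 0"
        using arg_cong[OF vw(3), of "\<lambda>s. s $ c"] by (simp add: restrict_coords_def)
    qed
    then show "v = w"
      by simp
  qed
  moreover have "vec.span W = W"
    using W by (simp add: vec.span_eq_iff)
  ultimately have "vec.dim (?R ` W) = vec.dim W"
    using vec.dim_image_eq[OF linear_restrict_coords, of \<rho> C W] by metis
  moreover have "?R ` W = coordspace C"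
  proof (intro subset_antisym subsetI)
    fix s :: "'a ^ 'c" assume s: "s \<in> coordspace C"
    then obtain w where "w \<in> W" "\<forall>c\<in>C. w $ \<rho> c = s $ c"
      using surj by blast
    then show "s \<in> ?R ` W"
      using s by (intro image_eqI[of _ _ w]) (auto simp: restrict_coords_def coordspace_def vec_eq_iff)
  qed (auto simp: restrict_coords_def coordspace_def)
  ultimately show ?thesis
    by (simp add: coordspace_def dim_substandard_cart)
qed

section \<open>Graphs of polynomial maps are non-singular\<close>

text \<open>
  \<open>\<Phi>\<close> is a section of the projection onto the coordinates \<open>\<rho> ` C\<close>, so its
  image is the graph of a polynomial map. A tangent vector is determined by these coordinates because of the
  equations \<open>x = \<Phi> (R x)\<close>, where \<open>R\<close> is the projection, and all values occur,
  as velocities of the images of lines. So both the tangent space and the image have dimension \<open>card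
  C\<close>.
\<close>

lemma nonsingular_at_section_image:
  fixes \<Phi> :: "'k::alg_closed_field ^ 'u::finite \<Rightarrow> 'k ^ 'v::finite"
  assumes \<Phi>: "polymap \<Phi>" and retract: "\<And>s c. s \<in> coordspace C \<Longrightarrow> c \<in> C \<Longrightarrow> \<Phi> s $ \<rho> c = s $ c"
    and y: "y \<in> \<Phi> ` coordspace C"
  shows "nonsingular_at (\<Phi> ` coordspace C) y"
proof -
  let ?Z = "\<Phi> ` coordspace C" and ?R = "restrict_coords \<rho> C :: 'k ^ 'v \<Rightarrow> 'k ^ 'u"
  have R: "?R (\<Phi> s) = s" if "s \<in> coordspace C" for s
    using that retract[OF that] by (auto simp: restrict_coords_def coordspace_def vec_eq_iff)
  obtain e where e: "bij_betw e {..<card C} C"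
    using ex_bij_betw_nat_finite[of C] by (auto simp: atLeast0LessThan)
  have e_C: "e k \<in> C" if "k < card C" for k
    using e that by (auto simp: bij_betw_def)
  have "variety_dim ?Z = enat (card C)"
  proof (rule variety_dim_parametrised[OF \<Phi> order_refl zclosure_subset e, of "\<lambda>k x. x $ \<rho> (e k)"])
    fix k assume k: "k < card C"
    have sub: "coordspace (e ` {..<l}) \<subseteq> (coordspace C :: ('k ^ 'u) set)" if "l \<le> card C" for l
      using that e_C by (intro coordspace_mono) auto
    show "\<Phi> s $ \<rho> (e k) = 0" if s: "s \<in> coordspace (e ` {..<k})" for s
    proof -
      have "e k \<notin> e ` {..<k}"
        using e k by (fastforce simp: bij_betw_def inj_on_def)
      then show ?thesis
        using retract[of s "e k"] sub[of k] s k e_C by (auto simp: coordspace_def)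
    qed
    have "axis (e k) 1 \<in> (coordspace (e ` {..<Suc k}) :: ('k ^ 'u) set)"
      by (auto simp: coordspace_def axis_def)
    moreover have "\<Phi> (axis (e k) 1) $ \<rho> (e k) = 1"
      using sub[of "Suc k"] calculation k e_C by (subst retract) (auto simp: axis_def)
    ultimately show "\<exists>s\<in>coordspace (e ` {..<Suc k}). \<Phi> s $ \<rho> (e k) \<noteq> 0"
      by (metis one_neq_zero)
  qed simp_all
  moreover have "prime_locus ?Z"
    using \<Phi> by (rule prime_locus_image_coordspace)
  ultimately have ld: "local_dim ?Z y = enat (card C)"
    using local_dim_irreducible y by metis
  obtain s0 where s0: "s0 \<in> coordspace C" "y = \<Phi> s0"
    using y by blast
  have "vec.dim (tangent_space ?Z y) = card C"
  proof (rule dim_eq_card_coords[OF subspace_tangent_space, where \<rho> = \<rho>])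
    fix w assume w: "w \<in> tangent_space ?Z y" "\<And>c. c \<in> C \<Longrightarrow> w $ \<rho> c = 0"
    show "w = 0"
      unfolding vec_eq_iff
    proof
      fix i
      (* along w the projection ?R does not change, so this equation of the image restricts to s * w $ i *)
      let ?f = "\<lambda>x. x $ i - \<Phi> (?R x) $ i"
      have "polymap ?R"
        unfolding polymap_def
      proof
        fix c show "polyfun (\<lambda>x. ?R x $ c)"
          by (cases "c \<in> C") (simp_all add: restrict_coords_def)
      qed
      then have "polyfun (\<lambda>x. \<Phi> (?R x) $ i)"
        using polyfun_compose[of "\<lambda>s. \<Phi> s $ i" ?R] \<Phi> unfolding polymap_def by blast
      then have f: "polyfun ?f"
        by simp
      have f0: "?f x = 0" if "x \<in> ?Z" for x
        using that R by auto
      have "?R (y + s *s w) = ?R y" for s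
        using w(2) by (simp add: restrict_coords_def vec_eq_iff)
      then have "?f (y + s *s w) = poly [:0, w $ i:] s" for s
        using s0 R by simp
      then have "poly (pderiv [:0, w $ i:]) 0 = 0"
        using tangent_space_equation[OF w(1) f f0] by blast
      then show "w $ i = 0 $ i"
        by (simp add: pderiv_pCons)
    qed
  next
    fix s :: "'k ^ 'u" assume s: "s \<in> coordspace C"
    define l where "l = (\<lambda>i. [:s0 $ i, s $ i:])"
    obtain c where c: "\<And>t. \<Phi> (curve l t) = curve c t"
      by (rule polymap_curve[OF \<Phi>, where c = l]) (rule that)
    have l: "curve l t \<in> coordspace C" for t
      using s s0 by (simp add: l_def coordspace_def)
    have "curve l 0 = s0"
      by (simp add: l_def vec_eq_iff)
    then have "curve c 0 = y"
      using c[of 0] s0 by simp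
    moreover have "curve c t \<in> ?Z" for t
      using l c by (metis imageI)
    ultimately have "(\<chi> i. poly (pderiv (c i)) 0) \<in> tangent_space ?Z y"
      using velocity_in_tangent_space[of c ?Z] by simp
    moreover have "(\<chi> i. poly (pderiv (c i)) 0) $ \<rho> b = s $ b" if b: "b \<in> C" for b
    proof -
      have "poly (c (\<rho> b)) t = poly (l b) t" for t
        using retract[OF l b] by (simp add: c)
      then have "c (\<rho> b) = l b"
        by (rule poly_eqI_infinite)
      then show ?thesis
        by (simp add: l_def pderiv_pCons)
    qed
    ultimately show "\<exists>w\<in>tangent_space ?Z y. \<forall>c\<in>C. w $ \<rho> c = s $ c"
      by blast
  qed
  then show ?thesis
    using y ld by (simp add: nonsingular_at_def)
qed

section \<open>Degeneracy loci\<close>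

text \<open>
  If all these determinants vanish, apply this to a choice of \<open>f\<close> that enumerates a basis of the
  span of \<open>A\<close>, with repetitions if the basis is small: a vector in the kernel of this matrix
  annihilates all of \<open>A\<close>.
\<close>

lemma common_kernel_iff_det:
  fixes A :: "('k::field ^ 'n::finite) set"
  shows "(\<exists>u. u \<noteq> 0 \<and> (\<forall>a\<in>A. (\<Sum>i\<in>UNIV. a $ i * u $ i) = 0)) \<longleftrightarrow>
    (\<forall>f. (\<forall>k. f k \<in> A) \<longrightarrow> det (\<chi> k. f k) = 0)" (is "?L \<longleftrightarrow> ?D")
proof -
  have det: "det M = 0 \<longleftrightarrow> (\<exists>u. u \<noteq> 0 \<and> (\<forall>k. (\<Sum>i\<in>UNIV. M $ k $ i * u $ i) = 0))" for M :: "'k ^ 'n ^ 'n"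
  proof -
    have "det M = 0 \<longleftrightarrow> \<not> inj ((*v) M)"
      using det_nz_iff_inj_gen[of "(*v) M"]
      by (simp add: matrix_vector_mul_linear_gen matrix_of_matrix_vector_mul) blast
    also have "\<dots> \<longleftrightarrow> (\<exists>u. u \<noteq> 0 \<and> M *v u = 0)"
      unfolding vec.inj_iff_eq_0 by blast
    finally show ?thesis
      by (simp add: vec_eq_iff matrix_vector_mult_def)
  qed
  show ?thesis
  proof
    assume ?L
    then show ?D
      unfolding det by (metis vec_lambda_beta)
  next
    assume D: ?D
    obtain B where B: "B \<subseteq> A" "vec.independent B" "A \<subseteq> vec.span B" "card B = vec.dim A"
      by (rule vec.basis_exists)
    show ?L
    proof (cases "B = {}")
      case True
      then have "\<forall>a\<in>A. a = 0"
        using B(3) by auto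
      moreover have "((\<chi> i. 1) :: 'k ^ 'n) \<noteq> 0"
        by (simp add: vec_eq_iff)
      ultimately show ?thesis
        by (intro exI[of _ "\<chi> i. 1"]) auto
    next
      case False
      have "finite B" "card B \<le> CARD('n)"
        using B by (auto intro: vec.finiteI_independent simp: dim_subset_UNIV_cart_gen)
      then obtain f :: "'n \<Rightarrow> 'k ^ 'n" where f: "f ` UNIV = B"
        using card_le_inj[of B "UNIV :: 'n set"] inj_on_iff_surj[OF False, of "UNIV :: 'n set"] by auto
      then have "det (\<chi> k. f k) = 0"
        using D B(1) by blast
      then obtain u where u: "u \<noteq> 0" "\<forall>k. (\<Sum>i\<in>UNIV. f k $ i * u $ i) = 0"
        unfolding det by auto
      have "vec.subspace {a. (\<Sum>i\<in>UNIV. a $ i * u $ i) = 0}"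
        unfolding vec.subspace_def
        by (auto simp: distrib_right sum.distrib mult.assoc simp flip: sum_distrib_left)
      moreover have "B \<subseteq> {a. (\<Sum>i\<in>UNIV. a $ i * u $ i) = 0}"
        using u(2) f by blast
      ultimately have "vec.span B \<subseteq> {a. (\<Sum>i\<in>UNIV. a $ i * u $ i) = 0}"
        by (intro vec.span_minimal)
      then show ?thesis
        using u(1) B(3) by blast
    qed
  qed
qed

text \<open>
  Having a nonzero solution is a closed condition on the coefficients of a homogeneous linear system. This is
  the one place where the completeness of projective space enters, and for linear systems it reduces to
  determinants.
\<close>

lemma closedin_common_kernel:
  fixes r :: "'r \<Rightarrow> 'n::finite \<Rightarrow> 'k::field ^ 'v::finite \<Rightarrow> 'k"
  assumes r: "\<And>\<rho> i. \<rho> \<in> R \<Longrightarrow> polyfun (r \<rho> i)"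
  shows "closedin zariski {y. \<exists>u::'k ^ 'n. u \<noteq> 0 \<and> (\<forall>\<rho>\<in>R. (\<Sum>i\<in>UNIV. r \<rho> i y * u $ i) = 0)}"
proof -
  define M :: "('n \<Rightarrow> 'r) \<Rightarrow> 'k ^ 'v \<Rightarrow> 'k ^ 'n ^ 'n" where "M = (\<lambda>h y. \<chi> k i. r (h k) i y)"
  have "(\<exists>u::'k ^ 'n. u \<noteq> 0 \<and> (\<forall>\<rho>\<in>R. (\<Sum>i\<in>UNIV. r \<rho> i y * u $ i) = 0)) \<longleftrightarrow>
      (\<forall>h. (\<forall>k. h k \<in> R) \<longrightarrow> det (M h y) = 0)" (is "?L \<longleftrightarrow> ?D") for y
  proof -
    have "?L \<longleftrightarrow> (\<exists>u::'k ^ 'n. u \<noteq> 0 \<and> (\<forall>a\<in>(\<lambda>\<rho>. \<chi> i. r \<rho> i y) ` R. (\<Sum>i\<in>UNIV. a $ i * u $ i) = 0))"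
      by simp
    also have "\<dots> \<longleftrightarrow> (\<forall>f. (\<forall>k. f k \<in> (\<lambda>\<rho>. \<chi> i. r \<rho> i y) ` R) \<longrightarrow> det (\<chi> k. f k) = 0)"
      by (rule common_kernel_iff_det)
    also have "\<dots> \<longleftrightarrow> ?D"
    proof (intro iffI allI impI)
      fix f :: "'n \<Rightarrow> 'k ^ 'n" assume ?D "\<forall>k. f k \<in> (\<lambda>\<rho>. \<chi> i. r \<rho> i y) ` R"
      then obtain h where h: "\<forall>k. h k \<in> R" "\<forall>k. f k = (\<chi> i. r (h k) i y)"
        unfolding image_iff by metis
      then show "det (\<chi> k. f k) = 0"
        using \<open>?D\<close> by (auto simp: M_def)
    next
      fix h :: "'n \<Rightarrow> 'r"
      assume "\<forall>f. (\<forall>k. f k \<in> (\<lambda>\<rho>. \<chi> i. r \<rho> i y) ` R) \<longrightarrow> det (\<chi> k. f k) = 0" "\<forall>k. h k \<in> R"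
      then show "det (M h y) = 0"
        unfolding M_def by (auto dest: spec[of _ "\<lambda>k. \<chi> i. r (h k) i y"])
    qed
    finally show ?thesis .
  qed
  then have "{y. \<exists>u::'k ^ 'n. u \<noteq> 0 \<and> (\<forall>\<rho>\<in>R. (\<Sum>i\<in>UNIV. r \<rho> i y * u $ i) = 0)} =
      {y. \<forall>f\<in>(\<lambda>h y. det (M h y)) ` {h. \<forall>k. h k \<in> R}. f y = 0}"
    by simp
  moreover have "polyfun (\<lambda>y. det (M h y))" if "\<forall>k. h k \<in> R" for h
    unfolding det_def M_def using r that by simp
  ultimately show ?thesis
    unfolding closedin_zariski_polyfun
    by (intro exI[of _ "(\<lambda>h y. det (M h y)) ` {h. \<forall>k. h k \<in> R}"]) simp
qed

section \<open>Matrices of rank at most one\<close>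

definition outer :: "'k::field ^ 'm::finite \<Rightarrow> 'k ^ 'n::finite \<Rightarrow> 'k ^ ('m \<times> 'n)" where
  "outer u v = (\<chi> p. u $ fst p * v $ snd p)"

definition rank1_tangent :: "'k::field ^ 'm::finite \<Rightarrow> 'k ^ 'n::finite \<Rightarrow> ('k ^ ('m \<times> 'n)) set" where
  "rank1_tangent u v = {outer u a + outer b v | a b. True}"

text \<open>
  The entries in row \<open>i0\<close> or column \<open>j0\<close>. They index the free entries of a tangent
  matrix, and therefore serve at once as the coordinate set of a chart and as the labels of the parameters of
  the variety.
\<close>

definition star :: "'m \<Rightarrow> 'n \<Rightarrow> ('m \<times> 'n) set" where
  "star i0 j0 = {p. fst p = i0 \<or> snd p = j0}"

lemma outer_nth [simp]: "outer u v $ p = u $ fst p * v $ snd p"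
  by (simp add: outer_def)

lemma outer_scale: "outer (c *s u) v = c *s outer u v" "outer u (c *s v) = c *s outer u v"
  by (simp_all add: vec_eq_iff)

lemma outer_nonzero: "u \<noteq> 0 \<Longrightarrow> v \<noteq> 0 \<Longrightarrow> outer u v \<noteq> 0"
  by (auto simp: vec_eq_iff)

lemma outer_in_generic_det2 [simp]: "outer u v \<in> generic_det2"
  by (simp add: generic_det2_minors)

lemma scaled_outer_in_generic_det2 [simp]: "c *s outer u v \<in> generic_det2"
  using outer_in_generic_det2[of "c *s u" v] by (simp add: outer_scale)

lemma generic_det2E:
  assumes "x \<in> generic_det2"
  obtains u v where "x = outer u v"
proof (cases "x = 0")
  case True
  then show ?thesis
    by (intro that[of 0 0]) (simp add: vec_eq_iff)
next
  case False
  then obtain k l where kl: "x $ (k, l) \<noteq> 0"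
    by (auto simp: vec_eq_iff)
  have "x = outer (\<chi> i. x $ (i, l)) (\<chi> j. x $ (k, j) / x $ (k, l))"
    using assms[unfolded generic_det2_minors] kl by (auto simp: vec_eq_iff field_simps)
  then show ?thesis
    by (rule that)
qed

lemma prime_locus_generic_det2:
  "prime_locus (generic_det2 :: ('k::alg_closed_field ^ ('m::finite \<times> 'n::finite)) set)"
proof (rule prime_locus_if_curve_connected)
  fix x y :: "'k ^ ('m \<times> 'n)" assume "x \<in> generic_det2" "y \<in> generic_det2"
  then obtain u v u' v' where xy: "x = outer u v" "y = outer u' v'"
    by (metis generic_det2E)
  define c where "c = (\<lambda>p::'m \<times> 'n. [:u $ fst p, (u' - u) $ fst p:] * [:v $ snd p, (v' - v) $ snd p:])"
  have "curve c s = outer (u + s *s (u' - u)) (v + s *s (v' - v))" for s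
    by (simp add: c_def vec_eq_iff algebra_simps)
  then have "\<forall>s. curve c s \<in> generic_det2" "curve c 0 = x" "curve c 1 = y"
    by (simp_all add: xy)
  then show "\<exists>c. (\<forall>s. curve c s \<in> generic_det2) \<and> curve c 0 = x \<and> curve c 1 = y"
    by blast
qed

text \<open>
  For fixed \<open>u\<close> and \<open>v\<close>, the entries in row \<open>i0\<close> and column
  \<open>j0\<close> determine all others. The equations are written without denominators so that they
  specialise to the chart equations for \<open>u $ i0 = v $ j0 = 1\<close>.
\<close>

lemma rank1_tangent_iff:
  assumes "u $ i0 \<noteq> 0" "v $ j0 \<noteq> 0"
  shows "w \<in> rank1_tangent u v \<longleftrightarrow> (\<forall>i j. w $ (i, j) * (u $ i0 * v $ j0) + u $ i * v $ j * w $ (i0, j0) =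
    w $ (i, j0) * (u $ i0 * v $ j) + u $ i * v $ j0 * w $ (i0, j))"
proof
  assume R: "\<forall>i j. w $ (i, j) * (u $ i0 * v $ j0) + u $ i * v $ j * w $ (i0, j0) =
    w $ (i, j0) * (u $ i0 * v $ j) + u $ i * v $ j0 * w $ (i0, j)"
  define a where "a = (\<chi> j. w $ (i0, j) / u $ i0)"
  define b where "b = (\<chi> i. (w $ (i, j0) - u $ i * w $ (i0, j0) / u $ i0) / v $ j0)"
  have "w = outer u a + outer b v"
    unfolding vec_eq_iff
  proof
    fix p :: "'b \<times> 'c"
    obtain i j where p: "p = (i, j)"
      by (cases p)
    have "w $ (i, j) * (u $ i0 * v $ j0) =
        w $ (i, j0) * (u $ i0 * v $ j) + u $ i * v $ j0 * w $ (i0, j) - u $ i * v $ j * w $ (i0, j0)"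
      using R[rule_format, of i j] by (simp add: eq_diff_eq)
    also have "\<dots> = (outer u a + outer b v) $ p * (u $ i0 * v $ j0)"
      using assms by (simp add: p a_def b_def field_simps)
    finally show "w $ p = (outer u a + outer b v) $ p"
      using assms by (simp add: p)
  qed
  then show "w \<in> rank1_tangent u v"
    by (auto simp: rank1_tangent_def)
qed (auto simp: rank1_tangent_def algebra_simps)

lemma subspace_rank1_tangent: "vec.subspace (rank1_tangent u v)"
  unfolding vec.subspace_def
proof (intro conjI ballI allI)
  have "0 = outer u 0 + outer 0 v"
    by (simp add: vec_eq_iff)
  then show "0 \<in> rank1_tangent u v"
    by (auto simp: rank1_tangent_def)
next
  fix x y assume "x \<in> rank1_tangent u v" "y \<in> rank1_tangent u v"
  then obtain a b a' b' where xy: "x = outer u a + outer b v" "y = outer u a' + outer b' v"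
    by (auto simp: rank1_tangent_def)
  have "x + y = outer u (a + a') + outer (b + b') v"
    by (simp add: xy vec_eq_iff algebra_simps)
  then show "x + y \<in> rank1_tangent u v"
    by (auto simp: rank1_tangent_def)
next
  fix c x assume "x \<in> rank1_tangent u v"
  then obtain a b where x: "x = outer u a + outer b v"
    by (auto simp: rank1_tangent_def)
  have "c *s x = outer u (c *s a) + outer (c *s b) v"
    by (simp add: x vec_eq_iff algebra_simps)
  then show "c *s x \<in> rank1_tangent u v"
    by (auto simp: rank1_tangent_def)
qed

lemma rank1_tangent_scale:
  assumes "c \<noteq> 0" "d \<noteq> 0"
  shows "rank1_tangent (c *s u) (d *s v) = rank1_tangent u v"
proof -
  have *: "rank1_tangent (c *s u) (d *s v) \<subseteq> rank1_tangent u v" for c d and u :: "'a ^ 'b" and v :: "'a ^ 'c"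
  proof
    fix w assume "w \<in> rank1_tangent (c *s u) (d *s v)"
    then obtain a b where "w = outer (c *s u) a + outer b (d *s v)"
      by (auto simp: rank1_tangent_def)
    then have "w = outer u (c *s a) + outer (d *s b) v"
      by (simp add: outer_scale)
    then show "w \<in> rank1_tangent u v"
      by (auto simp: rank1_tangent_def)
  qed
  from *[of "inverse c" "c *s u" "inverse d" "d *s v"] * assms show ?thesis
    by (intro subset_antisym) (simp_all add: vector_smult_assoc)
qed

lemma card_star: "card (star (i0 :: 'm::finite) (j0 :: 'n::finite)) = CARD('m) + CARD('n) - 1"
proof -
  have "star i0 j0 = {i0} \<times> UNIV \<union> UNIV \<times> {j0}"
    by (auto simp: star_def)
  moreover have "({i0} \<times> UNIV) \<inter> (UNIV \<times> {j0}) = {(i0, j0)}"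
    by auto
  ultimately show ?thesis
    using card_Un_Int[of "{i0} \<times> (UNIV :: 'n set)" "(UNIV :: 'm set) \<times> {j0}"]
    by (simp add: card_cartesian_product)
qed

lemma dim_rank1_tangent:
  fixes u :: "'k::field ^ 'm::finite" and v :: "'k ^ 'n::finite"
  assumes "u \<noteq> 0" "v \<noteq> 0"
  shows "vec.dim (rank1_tangent u v) = CARD('m) + CARD('n) - 1"
proof -
  obtain i0 j0 where nz: "u $ i0 \<noteq> 0" "v $ j0 \<noteq> 0"
    using assms by (auto simp: vec_eq_iff)
  have "vec.dim (rank1_tangent u v) = card (star i0 j0)"
  proof (rule dim_eq_card_coords[OF subspace_rank1_tangent, where \<rho> = id])
    fix w assume w: "w \<in> rank1_tangent u v" "\<And>c. c \<in> star i0 j0 \<Longrightarrow> w $ id c = 0"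
    have "w $ (i0, j) = 0" "w $ (i, j0) = 0" for i j
      using w(2)[of "(i0, j)"] w(2)[of "(i, j0)"] by (simp_all add: star_def)
    then show "w = 0"
      using w(1) nz unfolding rank1_tangent_iff[OF nz] by (auto simp: vec_eq_iff)
  next
    fix s :: "'k ^ ('m \<times> 'n)"
    define a where "a = (\<chi> j. s $ (i0, j) / u $ i0)"
    define b where "b = (\<chi> i. (s $ (i, j0) - u $ i * s $ (i0, j0) / u $ i0) / v $ j0)"
    have "outer u a + outer b v \<in> rank1_tangent u v"
      by (auto simp: rank1_tangent_def)
    moreover have "\<forall>c\<in>star i0 j0. (outer u a + outer b v) $ id c = s $ c"
      using nz by (auto simp: star_def a_def b_def field_simps)
    ultimately show "\<exists>w\<in>rank1_tangent u v. \<forall>c\<in>star i0 j0. w $ id c = s $ c"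
      by blast
  qed
  then show ?thesis
    by (simp add: card_star)
qed

text \<open>
  The matrices \<open>outer u a + outer b v\<close> are the velocities of \<open>outer (u + s *s b) (v + s *s
  a)\<close>. Conversely, linearising the minors through the nonzero entry \<open>(i0, j0)\<close> gives
  exactly the equations of \<open>rank1_tangent_iff\<close>.
\<close>

lemma tangent_space_generic_det2:
  fixes u :: "'k::alg_closed_field ^ 'm::finite" and v :: "'k ^ 'n::finite"
  assumes "u \<noteq> 0" "v \<noteq> 0"
  shows "tangent_space generic_det2 (outer u v) = rank1_tangent u v"
proof (intro subset_antisym subsetI)
  fix w assume "w \<in> rank1_tangent u v"
  then obtain a b where w: "w = outer u a + outer b v"
    by (auto simp: rank1_tangent_def)
  define c where "c = (\<lambda>p::'m \<times> 'n. [:u $ fst p, b $ fst p:] * [:v $ snd p, a $ snd p:])"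
  have "curve c s = outer (u + s *s b) (v + s *s a)" for s
    by (simp add: c_def vec_eq_iff algebra_simps)
  then have "curve c s \<in> generic_det2" "curve c 0 = outer u v" for s
    by simp_all
  then have "(\<chi> p. poly (pderiv (c p)) 0) \<in> tangent_space generic_det2 (outer u v)"
    using velocity_in_tangent_space[of c generic_det2] by simp
  moreover have "(\<chi> p. poly (pderiv (c p)) 0) = w"
    by (simp add: c_def w vec_eq_iff pderiv_mult pderiv_pCons)
  ultimately show "w \<in> tangent_space generic_det2 (outer u v)"
    by simp
next
  fix w assume w: "w \<in> tangent_space generic_det2 (outer u v)"
  obtain i0 j0 where nz: "u $ i0 \<noteq> 0" "v $ j0 \<noteq> 0"
    using assms by (auto simp: vec_eq_iff)
  show "w \<in> rank1_tangent u v"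
    unfolding rank1_tangent_iff[OF nz]
  proof (intro allI)
    fix i j
    let ?f = "\<lambda>x :: 'k ^ ('m \<times> 'n). x $ (i, j) * x $ (i0, j0) - x $ (i, j0) * x $ (i0, j)"
    let ?l = "\<lambda>p. [:outer u v $ p, w $ p:]"
    let ?Q = "?l (i, j) * ?l (i0, j0) - ?l (i, j0) * ?l (i0, j)"
    have "polyfun ?f"
      by simp
    moreover have "?f x = 0" if "x \<in> generic_det2" for x
      using that by (simp add: generic_det2_minors)
    moreover have "?f (outer u v + s *s w) = poly ?Q s" for s
      by (simp add: algebra_simps)
    ultimately have "poly (pderiv ?Q) 0 = 0"
      using tangent_space_equation[OF w] by blast
    then show "w $ (i, j) * (u $ i0 * v $ j0) + u $ i * v $ j * w $ (i0, j0) =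
        w $ (i, j0) * (u $ i0 * v $ j) + u $ i * v $ j0 * w $ (i0, j)"
      by (simp add: pderiv_mult pderiv_diff pderiv_pCons algebra_simps)
  qed
qed

text \<open>
  The variety is a cone that contains all matrix units.
\<close>

lemma tangent_space_generic_det2_0:
  "tangent_space (generic_det2 :: ('k::alg_closed_field ^ ('m::finite \<times> 'n::finite)) set) 0 = UNIV"
proof -
  have "outer u v \<in> tangent_space (generic_det2 :: ('k ^ ('m \<times> 'n)) set) 0" for u v
  proof -
    define c where "c = (\<lambda>p::'m \<times> 'n. [:0, outer u v $ p:])"
    have "curve c s = s *s outer u v" for s
      by (simp add: c_def vec_eq_iff)
    then have "curve c s \<in> generic_det2" "curve c 0 = 0" for s
      by simp_all
    then have "(\<chi> p. poly (pderiv (c p)) 0) \<in> tangent_space generic_det2 0"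
      using velocity_in_tangent_space[of c generic_det2] by simp
    moreover have "(\<chi> p. poly (pderiv (c p)) 0) = outer u v"
      by (simp add: c_def vec_eq_iff pderiv_pCons)
    ultimately show ?thesis
      by simp
  qed
  moreover have "axis p 1 = outer (axis (fst p) 1) (axis (snd p) 1 :: 'k ^ 'n)" for p :: "'m \<times> 'n"
    by (cases p) (auto simp: vec_eq_iff axis_def)
  ultimately have "cart_basis \<subseteq> tangent_space (generic_det2 :: ('k ^ ('m \<times> 'n)) set) 0"
    by (auto simp: cart_basis_def)
  then have "vec.span cart_basis \<subseteq> tangent_space (generic_det2 :: ('k ^ ('m \<times> 'n)) set) 0"
    using subspace_tangent_space by (rule vec.span_minimal)
  then show ?thesis
    by (simp add: span_cart_basis top_unique)
qed

section \<open>The affine parametrisation\<close>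

text \<open>
  A point \<open>s\<close> of \<open>coordspace (star i0 j0)\<close> encodes the scalar \<open>t\<close> at
  \<open>(i0, j0)\<close>, the vector \<open>u\<close> in column \<open>j0\<close> and the vector
  \<open>v\<close> in row \<open>i0\<close>, where \<open>u $ i0\<close> and \<open>v $ j0\<close> are
  normalised to 1.
\<close>

definition row_param :: "'m \<Rightarrow> 'n \<Rightarrow> 'k::field ^ ('m::finite \<times> 'n::finite) \<Rightarrow> 'k ^ 'm" where
  "row_param i0 j0 s = (\<chi> i. if i = i0 then 1 else s $ (i, j0))"

definition col_param :: "'m \<Rightarrow> 'n \<Rightarrow> 'k::field ^ ('m::finite \<times> 'n::finite) \<Rightarrow> 'k ^ 'n" where
  "col_param i0 j0 s = (\<chi> j. if j = j0 then 1 else s $ (i0, j))"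

definition det_param :: "'m \<Rightarrow> 'n \<Rightarrow> 'k::field ^ ('m::finite \<times> 'n::finite) \<Rightarrow> 'k ^ ('m \<times> 'n)" where
  "det_param i0 j0 s = s $ (i0, j0) *s outer (row_param i0 j0 s) (col_param i0 j0 s)"

lemma row_col_param_base [simp]: "row_param i0 j0 s $ i0 = 1" "col_param i0 j0 s $ j0 = 1"
  by (simp_all add: row_param_def col_param_def)

lemma row_col_param_nonzero [simp]: "row_param i0 j0 s \<noteq> 0" "col_param i0 j0 s \<noteq> 0"
  by (auto simp: row_param_def col_param_def vec_eq_iff)

lemma polyfun_row_col_param [simp]:
  "polyfun (\<lambda>s. row_param i0 j0 s $ i)" "polyfun (\<lambda>s. col_param i0 j0 s $ j)"
  by (cases "i = i0"; simp add: row_param_def) (cases "j = j0"; simp add: col_param_def)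

lemma polymap_det_param: "polymap (det_param i0 j0)"
  by (simp add: polymap_def det_param_def)

lemma det_param_star:
  "c \<in> star i0 j0 \<Longrightarrow> det_param i0 j0 s $ c = (if c = (i0, j0) then s $ c else s $ (i0, j0) * s $ c)"
  by (cases c) (auto simp: star_def det_param_def row_param_def col_param_def)

lemma ex_params:
  assumes nz: "u $ i0 \<noteq> 0" "v $ j0 \<noteq> 0"
  obtains s where "s \<in> coordspace (star i0 j0)" "det_param i0 j0 s = t *s outer u v"
    "rank1_tangent (row_param i0 j0 s) (col_param i0 j0 s) = rank1_tangent u v"
proof -
  define s where "s = (\<chi> p. if p = (i0, j0) then t * u $ i0 * v $ j0 else
    if snd p = j0 then u $ fst p / u $ i0 else if fst p = i0 then v $ snd p / v $ j0 else 0)"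
  have "s \<in> coordspace (star i0 j0)"
    by (auto simp: coordspace_def star_def s_def)
  moreover have uv: "row_param i0 j0 s = inverse (u $ i0) *s u" "col_param i0 j0 s = inverse (v $ j0) *s v"
    using nz by (auto simp: row_param_def col_param_def s_def vec_eq_iff field_simps)
  moreover have "det_param i0 j0 s = t *s outer u v"
    unfolding det_param_def uv using nz by (auto simp: s_def vec_eq_iff field_simps)
  moreover have "rank1_tangent (row_param i0 j0 s) (col_param i0 j0 s) = rank1_tangent u v"
    unfolding uv using nz by (intro rank1_tangent_scale) auto
  ultimately show ?thesis
    using that by blast
qed

lemma ex_bij_betw_first:
  assumes "finite C" "c \<in> C"
  obtains e where "bij_betw e {..<card C} C" "e 0 = c"
proof -
  obtain e where e: "bij_betw e {..<card C} C"
    using ex_bij_betw_nat_finite[OF assms(1)] by (auto simp: atLeast0LessThan)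
  then have "c \<in> e ` {..<card C}"
    using assms(2) by (simp add: bij_betw_imp_surj_on)
  then obtain k where k: "k < card C" "e k = c"
    by auto
  have "bij_betw (Transposition.transpose 0 k) {..<card C} {..<card C}"
    using k(1) by (intro permutes_imp_bij permutes_swap_id) auto
  then have "bij_betw (e \<circ> Transposition.transpose 0 k) {..<card C} C"
    using e by (rule bij_betw_trans)
  then show ?thesis
    using k(2) that[of "e \<circ> Transposition.transpose 0 k"] by simp
qed

text \<open>
  The parametrisation reaches all matrices with a nonzero entry at \<open>(i0, j0)\<close>, and these are
  dense since the variety is irreducible. The flag of parameters must begin with the scalar at \<open>(i0,
  j0)\<close>: as long as it is zero, all other parameters give the zero matrix.
\<close>

lemma variety_dim_generic_det2:
  "variety_dim (generic_det2 :: ('k::alg_closed_field ^ ('m::finite \<times> 'n::finite)) set) =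
    enat (CARD('m) + CARD('n) - 1)"
proof -
  fix i0 :: 'm and j0 :: 'n
  let ?X = "generic_det2 :: ('k ^ ('m \<times> 'n)) set" and ?C = "star i0 j0" and ?\<phi> = "det_param i0 j0"
  obtain e where e: "bij_betw e {..<card ?C} ?C" "e 0 = (i0, j0)"
    by (rule ex_bij_betw_first[of ?C "(i0, j0)"]) (auto simp: star_def)
  have e_C: "e k \<in> ?C" if "k < card ?C" for k
    using e that by (auto simp: bij_betw_def)
  have "variety_dim ?X = enat (card ?C)"
  proof (rule variety_dim_parametrised[OF polymap_det_param _ _ e(1), of i0 j0 ?X "\<lambda>k x. x $ e k"])
    show "?\<phi> ` coordspace ?C \<subseteq> ?X"
      by (auto simp: det_param_def)
    show "?X \<subseteq> zclosure (?\<phi> ` coordspace ?C)"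
    proof
      fix x assume x: "x \<in> ?X"
      have "f x = 0" if f: "polyfun f" "\<And>y. y \<in> ?\<phi> ` coordspace ?C \<Longrightarrow> f y = 0" for f
      proof -
        have "f y * y $ (i0, j0) = 0" if y: "y \<in> ?X" for y
        proof (cases "y $ (i0, j0) = 0")
          case False
          obtain u v where uv: "y = outer u v"
            using y by (rule generic_det2E)
          then have "u $ i0 \<noteq> 0" "v $ j0 \<noteq> 0"
            using False by auto
          then obtain s where "s \<in> coordspace ?C" "?\<phi> s = 1 *s outer u v"
            by (rule ex_params)
          then have "y \<in> ?\<phi> ` coordspace ?C"
            by (metis uv imageI vector_smult_lid)
          then show ?thesis
            using f(2) by simp
        qed simp
        then have "(\<forall>y\<in>?X. f y = 0) \<or> (\<forall>y\<in>?X. y $ (i0, j0) = 0)"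
          using prime_locus_generic_det2 f(1) polyfun_coord unfolding prime_locus_def by blast
        moreover have "outer (\<chi> i. 1) (\<chi> j. 1) \<in> ?X" "outer (\<chi> i. 1) (\<chi> j. 1) $ (i0, j0) \<noteq> (0 :: 'k)"
          by simp_all
        ultimately show ?thesis
          using x by blast
      qed
      then show "x \<in> zclosure (?\<phi> ` coordspace ?C)"
        unfolding zclosure_def zero_locus_def vanishing_ideal_def
        using polyfun_mpoly_eval by blast
    qed
  next
    fix k and s :: "'k ^ ('m \<times> 'n)" assume k: "k < card ?C" and s: "s \<in> coordspace (e ` {..<k})"
    have "e k \<notin> e ` {..<k}"
      using e k by (fastforce simp: bij_betw_def inj_on_def)
    then have "s $ e k = 0"
      using s unfolding coordspace_def by blast
    then show "?\<phi> s $ e k = 0"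
      by (auto simp: det_param_star[OF e_C[OF k]])
  next
    fix k assume k: "k < card ?C"
    define s :: "'k ^ ('m \<times> 'n)" where "s = (\<chi> p. if p \<in> e ` {..<Suc k} then 1 else 0)"
    have "s \<in> coordspace (e ` {..<Suc k})"
      by (simp add: coordspace_def s_def)
    moreover have "s $ (i0, j0) = 1" "s $ e k = 1"
      using e(2) by (force simp: s_def)+
    then have "?\<phi> s $ e k \<noteq> 0"
      by (auto simp: det_param_star[OF e_C[OF k]])
    ultimately show "\<exists>s :: 'k ^ ('m \<times> 'n)\<in>coordspace (e ` {..<Suc k}). ?\<phi> s $ e k \<noteq> 0"
      by blast
  qed simp
  then show ?thesis
    by (simp add: card_star)
qed

lemma gauss_rank_generic_det2:
  "gauss_rank (generic_det2 :: ('k::alg_closed_field ^ ('m::finite \<times> 'n::finite)) set) = CARD('m) + CARD('n) - 1"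
  by (simp add: gauss_rank_def variety_dim_generic_det2)

lemma Sing_generic_det2:
  assumes "CARD('m::finite) \<ge> 2" "CARD('n::finite) \<ge> 2"
  shows "Sing (generic_det2 :: ('k::alg_closed_field ^ ('m \<times> 'n)) set) = {0}"
proof -
  let ?X = "generic_det2 :: ('k ^ ('m \<times> 'n)) set"
  have ld: "local_dim ?X x = enat (CARD('m) + CARD('n) - 1)" if "x \<in> ?X" for x
    using local_dim_irreducible[OF prime_locus_generic_det2 that] by (simp add: variety_dim_generic_det2)
  have "nonsingular_at ?X x" if X: "x \<in> ?X" "x \<noteq> 0" for x
  proof -
    obtain u v where x: "x = outer u v"
      using X(1) by (rule generic_det2E)
    then have "u \<noteq> 0" "v \<noteq> 0"
      using X(2) by (auto simp: vec_eq_iff)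
    then show ?thesis
      using X(1) by (simp add: nonsingular_at_def ld x tangent_space_generic_det2 dim_rank1_tangent)
  qed
  moreover have "0 \<in> ?X"
    using scaled_outer_in_generic_det2[of 0] by simp
  moreover have "\<not> nonsingular_at ?X 0"
  proof
    assume "nonsingular_at ?X 0"
    then have "CARD('m) * CARD('n) = CARD('m) + CARD('n) - 1"
      using ld \<open>0 \<in> ?X\<close> by (simp add: nonsingular_at_def tangent_space_generic_det2_0 card_cart_basis)
    moreover obtain a b where "CARD('m) = Suc (Suc a)" "CARD('n) = Suc (Suc b)"
      using assms by (metis add_2_eq_Suc le_Suc_ex)
    ultimately show False
      by simp
  qed
  ultimately show ?thesis
    by (auto simp: Sing_def)
qed

lemma gauss_graph_generic_det2:
  assumes "CARD('m::finite) \<ge> 2" "CARD('n::finite) \<ge> 2"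
  shows "gauss_graph (generic_det2 :: ('k::alg_closed_field ^ ('m \<times> 'n)) set) =
    {(outer u v, rank1_tangent u v) | u v. u \<noteq> 0 \<and> v \<noteq> 0}"
proof (intro subset_antisym subsetI)
  fix z assume "z \<in> gauss_graph (generic_det2 :: ('k ^ ('m \<times> 'n)) set)"
  then obtain x where x: "x \<in> generic_det2" "x \<noteq> 0" "z = (x, tangent_space generic_det2 x)"
    by (auto simp: gauss_graph_def Sing_generic_det2[OF assms])
  obtain u v where uv: "x = outer u v"
    using x(1) generic_det2E by blast
  then have "u \<noteq> 0" "v \<noteq> 0"
    using x(2) by (auto simp: vec_eq_iff)
  then show "z \<in> {(outer u v, rank1_tangent u v) | u v. u \<noteq> 0 \<and> v \<noteq> 0}"
    using x(3) by (auto simp: uv tangent_space_generic_det2)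
next
  fix z :: "('k ^ ('m \<times> 'n)) \<times> ('k ^ ('m \<times> 'n)) set"
  assume "z \<in> {(outer u v, rank1_tangent u v) | u v. u \<noteq> 0 \<and> v \<noteq> 0}"
  then show "z \<in> gauss_graph generic_det2"
    unfolding gauss_graph_def Sing_generic_det2[OF assms]
    using tangent_space_generic_det2 outer_nonzero by fastforce
qed

section \<open>Charts of the Grassmannian\<close>

text \<open>
  The subspace that the chart assigns to \<open>y\<close>: the graph of a linear map from the coordinates in
  \<open>B\<close> to the remaining ones, with matrix entries \<open>y $ Inr (i, j)\<close>.
\<close>

definition chart_space :: "'v::finite set \<Rightarrow> 'k::field ^ ('v + 'v \<times> 'v) \<Rightarrow> ('k ^ 'v) set" where
  "chart_space B y = {w. \<forall>j\<in>-B. w $ j = (\<Sum>i\<in>B. y $ Inr (i, j) * w $ i)}"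

lemma chart_eq: "chart B y = (\<chi> i. y $ Inl i, chart_space B y)"
  by (simp add: chart_def chart_space_def)

lemma subspace_chart_space: "vec.subspace (chart_space B y)"
  unfolding vec.subspace_def chart_space_def
  by (auto simp: distrib_left sum.distrib mult.left_commute simp flip: sum_distrib_left)

lemma chart_space_extend:
  obtains w where "w \<in> chart_space B y" "\<And>b. b \<in> B \<Longrightarrow> w $ b = s $ b"
proof -
  define w where "w = (\<chi> j. if j \<in> B then s $ j else \<Sum>i\<in>B. y $ Inr (i, j) * s $ i)"
  have "w \<in> chart_space B y"
    by (auto simp: chart_space_def w_def intro!: sum.cong)
  then show ?thesis
    by (rule that) (simp add: w_def)
qed

lemma chart_space_in_Gr: "chart_space B y \<in> Gr (card B)"
proof -
  have "vec.dim (chart_space B y) = card B"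
  proof (rule dim_eq_card_coords[OF subspace_chart_space, where \<rho> = id])
    fix w assume w: "w \<in> chart_space B y" "\<And>c. c \<in> B \<Longrightarrow> w $ id c = 0"
    have "w $ j = 0" for j
      using w by (cases "j \<in> B") (auto simp: chart_space_def)
    then show "w = 0"
      by (simp add: vec_eq_iff)
  next
    fix s
    show "\<exists>w\<in>chart_space B y. \<forall>c\<in>B. w $ id c = s $ c"
      using chart_space_extend[of B y s] by (metis id_apply)
  qed
  then show ?thesis
    by (simp add: Gr_def subspace_chart_space)
qed

lemma chart_inj:
  assumes dom: "y \<in> chart_dom B" "y' \<in> chart_dom B" and eq: "chart B y = chart B y'"
  shows "y = y'"
  unfolding vec_eq_iff
proof
  fix k
  have l: "y $ Inl i = y' $ Inl i" for i
    using arg_cong[OF eq, of "\<lambda>z. fst z $ i"] by (simp add: chart_eq)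
  have r: "y $ Inr (i, j) = y' $ Inr (i, j)" for i j
  proof (cases "i \<in> B \<and> j \<notin> B")
    case True
    obtain w where w: "w \<in> chart_space B y" "\<And>b. b \<in> B \<Longrightarrow> w $ b = axis i 1 $ b"
      using chart_space_extend[of B y "axis i 1"] by blast
    have w': "w \<in> chart_space B y'"
      using w(1) eq by (simp add: chart_eq)
    have *: "w $ j = z $ Inr (i, j)" if "w \<in> chart_space B z" for z
    proof -
      have "w $ j = (\<Sum>b\<in>B. z $ Inr (b, j) * w $ b)"
        using that True by (simp add: chart_space_def)
      also have "\<dots> = (\<Sum>b\<in>B. if b = i then z $ Inr (b, j) else 0)"
        by (rule sum.cong) (auto simp: w(2) axis_def)
      finally show ?thesis
        using True by simp
    qed
    show ?thesis
      using *[OF w(1)] *[OF w'] by simp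
  qed (use dom in \<open>auto simp: chart_dom_def\<close>)
  show "y $ k = y' $ k"
    using l r by (cases k) auto
qed

lemma chart_preimage_Gr_diff:
  "card B = d \<Longrightarrow> chart_preimage B (UNIV \<times> Gr d - Z) = chart_dom B - chart_preimage B Z"
  using chart_space_in_Gr by (auto simp: chart_preimage_def chart_eq)

lemma closedin_zariski_Gr:
  assumes "Z \<subseteq> UNIV \<times> Gr d"
    and "\<And>B. card B = d \<Longrightarrow> closedin (subtopology zariski (chart_dom B)) (chart_preimage B Z)"
  shows "closedin (zariski_Gr d) Z"
proof -
  have open_if_closed: "openin (zariski_Gr d) (UNIV \<times> Gr d - Y)"
    if "\<And>B. card B = d \<Longrightarrow> closedin (subtopology zariski (chart_dom B)) (chart_preimage B Y)" for Y
    unfolding openin_zariski_Gr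
    using that by (auto simp: chart_preimage_Gr_diff closedin_def topspace_subtopology)
  have "openin (zariski_Gr d) (UNIV \<times> Gr d - {})"
    by (rule open_if_closed) (simp add: chart_preimage_def)
  then have "UNIV \<times> Gr d \<subseteq> topspace (zariski_Gr d)"
    unfolding Diff_empty by (rule openin_subset)
  moreover have "topspace (zariski_Gr d) \<subseteq> UNIV \<times> Gr d"
    by (rule conjunct1[OF iffD1[OF openin_zariski_Gr openin_topspace]])
  ultimately have top: "topspace (zariski_Gr d) = UNIV \<times> Gr d"
    by (rule subset_antisym[rotated])
  show ?thesis
    unfolding closedin_def top using open_if_closed[of Z] assms by blast
qed

lemma openin_zariski_Gr_chart:
  assumes "openin (zariski_Gr d) U" "card B = d" "y \<in> chart_dom B" "chart B y \<in> U"
  obtains f where "polyfun f" "f y \<noteq> 0"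
    "\<And>y'. y' \<in> chart_dom B \<Longrightarrow> f y' \<noteq> 0 \<Longrightarrow> chart B y' \<in> U"
proof -
  have "openin (subtopology zariski (chart_dom B)) (chart_preimage B U)"
    using assms by (simp add: openin_zariski_Gr)
  then obtain V where V: "openin zariski V" "chart_preimage B U = V \<inter> chart_dom B"
    by (auto simp: openin_subtopology)
  then obtain S where S: "V = - zero_locus S"
    by (auto simp: openin_zariski)
  have "y \<in> chart_preimage B U"
    using assms by (simp add: chart_preimage_def)
  then obtain p where p: "p \<in> S" "mpoly_eval p y \<noteq> 0"
    unfolding V(2) S by (auto simp: zero_locus_def)
  show ?thesis
  proof (rule that[of "mpoly_eval p"])
    fix y' assume "y' \<in> chart_dom B" "mpoly_eval p y' \<noteq> 0"
    then have "y' \<in> chart_preimage B U"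
      unfolding V(2) S using p(1) by (auto simp: zero_locus_def)
    then show "chart B y' \<in> U"
      by (simp add: chart_preimage_def)
  qed (use p in auto)
qed

section \<open>Splitting off a vector as a closed condition\<close>

text \<open>
  \<open>\<pi>\<close> arranges the coordinates in a table with rows \<open>'a\<close> and columns
  \<open>'l\<close>. The condition says that \<open>W\<close> contains \<open>outer u a\<close> for every
  \<open>a\<close>, and that the columns of \<open>x\<close> are multiples of \<open>u\<close>. For matrices,
  \<open>\<pi> = id\<close> expresses this for \<open>u\<close>, and \<open>\<pi> = prod.swap\<close>
  expresses the transposed condition for \<open>v\<close>.
\<close>

definition splits_along :: "('v \<Rightarrow> 'a \<times> 'l) \<Rightarrow> 'k::field ^ 'v::finite \<Rightarrow> ('k ^ 'v) set \<Rightarrow> ('k ^ 'a::finite) \<Rightarrow> 'l::finite itself \<Rightarrow> bool" where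
  "splits_along \<pi> x W u (_ :: 'l itself) \<longleftrightarrow> u \<noteq> 0 \<and>
     (\<forall>a :: 'k ^ 'l. (\<chi> p. u $ fst (\<pi> p) * a $ snd (\<pi> p)) \<in> W) \<and>
     (\<forall>p q. snd (\<pi> p) = snd (\<pi> q) \<longrightarrow> u $ fst (\<pi> p) * x $ q = u $ fst (\<pi> q) * x $ p)"

text \<open>
  In a chart, \<open>splits_along\<close> is a homogeneous linear system for \<open>u\<close>, with the
  functions \<open>r \<rho> i\<close> as coefficients. The indices \<open>Inl (l, c)\<close> say that the
  outer product of \<open>u\<close> and the \<open>l\<close>-th unit vector satisfies the chart equation for
  the entry \<open>c\<close>; the indices \<open>Inr (p, q)\<close> compare two entries of a column of
  \<open>x\<close>.
\<close>

lemma closedin_splits_along: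
  fixes \<pi> :: "'v::finite \<Rightarrow> 'a::finite \<times> 'l::finite" and B :: "'v set"
  shows "closedin zariski {y :: 'k::field ^ ('v + 'v \<times> 'v).
    \<exists>u. splits_along \<pi> (\<chi> i. y $ Inl i) (chart_space B y) u TYPE('l)}"
proof -
  define R where "R = Inl ` {(l :: 'l, c). c \<notin> B} \<union> Inr ` {(p :: 'v, q). snd (\<pi> p) = snd (\<pi> q)}"
  define r :: "'l \<times> 'v + 'v \<times> 'v \<Rightarrow> 'a \<Rightarrow> 'k ^ ('v + 'v \<times> 'v) \<Rightarrow> 'k" where
    "r = (\<lambda>\<rho> i y. case \<rho> of
        Inl (l, c) \<Rightarrow> (if \<pi> c = (i, l) then 1 else 0) - (\<Sum>b\<in>B. if \<pi> b = (i, l) then y $ Inr (b, c) else 0)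
      | Inr (p, q) \<Rightarrow> (if fst (\<pi> p) = i then y $ Inl q else 0) - (if fst (\<pi> q) = i then y $ Inl p else 0))"
  have r: "polyfun (r \<rho> i)" for \<rho> i
    unfolding r_def by (cases \<rho>) (auto intro!: polyfun_diff polyfun_sum polyfun_if)
  have r1: "(\<Sum>i\<in>UNIV. r (Inl (l, c)) i y * u $ i) =
      (if snd (\<pi> c) = l then u $ fst (\<pi> c) else 0) -
      (\<Sum>b\<in>B. y $ Inr (b, c) * (if snd (\<pi> b) = l then u $ fst (\<pi> b) else 0))" for l c y u
  proof -
    have d: "(\<Sum>i\<in>UNIV. if \<pi> b = (i, l) then z * u $ i else 0) = z * (if snd (\<pi> b) = l then u $ fst (\<pi> b) else 0)"
      for b z
    proof -
      have "(\<Sum>i\<in>UNIV. if \<pi> b = (i, l) then z * u $ i else 0) =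
          (\<Sum>i\<in>UNIV. if fst (\<pi> b) = i then (if snd (\<pi> b) = l then z * u $ i else 0) else 0)"
        by (rule sum.cong) (auto simp: prod_eq_iff)
      then show ?thesis
        by simp
    qed
    have "(\<Sum>i\<in>UNIV. r (Inl (l, c)) i y * u $ i) =
        (\<Sum>i\<in>UNIV. if \<pi> c = (i, l) then 1 * u $ i else 0) -
        (\<Sum>i\<in>UNIV. \<Sum>b\<in>B. if \<pi> b = (i, l) then y $ Inr (b, c) * u $ i else 0)"
      unfolding r_def by (simp add: left_diff_distrib sum_subtractf sum_distrib_right if_distrib[of "\<lambda>z. z * _"] cong: if_cong)
    also have "\<dots> = (if snd (\<pi> c) = l then u $ fst (\<pi> c) else 0) -
        (\<Sum>b\<in>B. \<Sum>i\<in>UNIV. if \<pi> b = (i, l) then y $ Inr (b, c) * u $ i else 0)"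
      by (subst sum.swap) (simp only: d d[where z = 1, unfolded mult_1] mult_1)
    finally show ?thesis
      unfolding d .
  qed
  have r2: "(\<Sum>i\<in>UNIV. r (Inr (p, q)) i y * u $ i) =
      u $ fst (\<pi> p) * y $ Inl q - u $ fst (\<pi> q) * y $ Inl p" for p q y u
    unfolding r_def by (simp add: left_diff_distrib sum_subtractf if_distrib[of "\<lambda>z. z * _"] cong: if_cong)
  have W: "(\<forall>a :: 'k ^ 'l. (\<chi> p. u $ fst (\<pi> p) * a $ snd (\<pi> p)) \<in> chart_space B y) \<longleftrightarrow>
      (\<forall>l c. c \<notin> B \<longrightarrow> (if snd (\<pi> c) = l then u $ fst (\<pi> c) else 0) =
        (\<Sum>b\<in>B. y $ Inr (b, c) * (if snd (\<pi> b) = l then u $ fst (\<pi> b) else 0)))" (is "?L \<longleftrightarrow> ?E") for u y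
  proof -
    have ax: "(\<chi> p. u $ fst (\<pi> p) * axis l 1 $ snd (\<pi> p)) = (\<chi> p. if snd (\<pi> p) = l then u $ fst (\<pi> p) else 0)" for l
      by (auto simp: vec_eq_iff axis_def)
    have E: "?E \<longleftrightarrow> (\<forall>l. (\<chi> p. if snd (\<pi> p) = l then u $ fst (\<pi> p) else 0) \<in> chart_space B y)"
      by (simp only: chart_space_def mem_Collect_eq vec_lambda_beta Ball_def Compl_iff)
    show ?thesis
    proof
      assume ?L
      then show ?E
        unfolding E ax[symmetric] by blast
    next
      assume e: ?E
      show ?L
      proof
        fix a :: "'k ^ 'l"
        have "(\<chi> p. u $ fst (\<pi> p) * a $ snd (\<pi> p)) =
            (\<Sum>l\<in>UNIV. a $ l *s (\<chi> p. if snd (\<pi> p) = l then u $ fst (\<pi> p) else 0))"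
          by (simp add: vec_eq_iff if_distrib[of "\<lambda>z. _ * z"] mult.commute cong: if_cong)
        also have "\<dots> \<in> chart_space B y"
          using e unfolding E
          by (intro vec.subspace_sum vec.subspace_scale subspace_chart_space) auto
        finally show "(\<chi> p. u $ fst (\<pi> p) * a $ snd (\<pi> p)) \<in> chart_space B y" .
      qed
    qed
  qed
  have "splits_along \<pi> (\<chi> i. y $ Inl i) (chart_space B y) u TYPE('l) \<longleftrightarrow>
      u \<noteq> 0 \<and> (\<forall>\<rho>\<in>R. (\<Sum>i\<in>UNIV. r \<rho> i y * u $ i) = 0)" for u y
    unfolding splits_along_def W R_def ball_Un by (auto simp: r1 r2)
  then show ?thesis
    using closedin_common_kernel[of R r] r by simp
qed

section \<open>The Nash blowup\<close>

definition nash_locus :: "(('k::field ^ ('m::finite \<times> 'n::finite)) \<times> ('k ^ ('m \<times> 'n)) set) set" where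
  "nash_locus = {(t *s outer u v, rank1_tangent u v) | t u v. u \<noteq> 0 \<and> v \<noteq> 0}"

lemma rank1_tangent_in_Gr:
  fixes u :: "'k::field ^ 'm::finite" and v :: "'k ^ 'n::finite"
  shows "u \<noteq> 0 \<Longrightarrow> v \<noteq> 0 \<Longrightarrow> rank1_tangent u v \<in> Gr (CARD('m) + CARD('n) - 1)"
  by (simp add: Gr_def subspace_rank1_tangent dim_rank1_tangent)

lemma outer_in_rank1_tangent: "outer u a \<in> rank1_tangent u v" "outer b v \<in> rank1_tangent u v"
proof -
  have "outer u a = outer u a + outer 0 v" "outer b v = outer u 0 + outer b v"
    by (simp_all add: vec_eq_iff)
  then show "outer u a \<in> rank1_tangent u v" "outer b v \<in> rank1_tangent u v"
    unfolding rank1_tangent_def by blast+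
qed

text \<open>
  A subspace that contains all \<open>outer u a\<close> and all \<open>outer b v\<close> contains
  \<open>rank1_tangent u v\<close>, and equals it if the dimensions agree. A matrix with columns proportional
  to \<open>u\<close> and rows proportional to \<open>v\<close> is a multiple of \<open>outer u v\<close>.
\<close>

lemma nash_locus_iff_splits:
  fixes x :: "'k::field ^ ('m::finite \<times> 'n::finite)"
  shows "(x, W) \<in> nash_locus \<longleftrightarrow> W \<in> Gr (CARD('m) + CARD('n) - 1) \<and>
    (\<exists>u. splits_along id x W u TYPE('n)) \<and> (\<exists>v. splits_along prod.swap x W v TYPE('m))"
proof
  assume "(x, W) \<in> nash_locus"
  then obtain t u v where nz: "u \<noteq> 0" "v \<noteq> 0" and x: "x = t *s outer u v" and W: "W = rank1_tangent u v"
    by (auto simp: nash_locus_def)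
  have "splits_along id x W u TYPE('n)"
    using nz outer_in_rank1_tangent(1)[of u _ v] by (auto simp: splits_along_def x W outer_def)
  moreover have "splits_along prod.swap x W v TYPE('m)"
    using nz outer_in_rank1_tangent(2)[of _ v u] by (auto simp: splits_along_def x W outer_def mult.commute)
  ultimately show "W \<in> Gr (CARD('m) + CARD('n) - 1) \<and>
    (\<exists>u. splits_along id x W u TYPE('n)) \<and> (\<exists>v. splits_along prod.swap x W v TYPE('m))"
    using rank1_tangent_in_Gr[OF nz] W by blast
next
  assume *: "W \<in> Gr (CARD('m) + CARD('n) - 1) \<and>
    (\<exists>u. splits_along id x W u TYPE('n)) \<and> (\<exists>v. splits_along prod.swap x W v TYPE('m))"
  then obtain u v where u: "splits_along id x W u TYPE('n)" and v: "splits_along prod.swap x W v TYPE('m)"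
    by blast
  have nz: "u \<noteq> 0" "v \<noteq> 0"
    using u v by (simp_all add: splits_along_def)
  have W: "vec.subspace W" "vec.dim W = CARD('m) + CARD('n) - 1"
    using * by (simp_all add: Gr_def)
  have "outer u a \<in> W" for a
    using u by (simp add: splits_along_def outer_def)
  moreover have "outer b v \<in> W" for b
    using v by (simp add: splits_along_def outer_def mult.commute)
  ultimately have "rank1_tangent u v \<subseteq> W"
    using W(1) by (auto simp: rank1_tangent_def intro: vec.subspace_add)
  then have "rank1_tangent u v = W"
    using W by (intro vec.subspace_dim_equal) (simp_all add: subspace_rank1_tangent dim_rank1_tangent nz)
  moreover obtain i0 j0 where nz0: "u $ i0 \<noteq> 0" "v $ j0 \<noteq> 0"
    using nz by (auto simp: vec_eq_iff)
  have "x = (x $ (i0, j0) / (u $ i0 * v $ j0)) *s outer u v"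
    unfolding vec_eq_iff
  proof
    fix p :: "'m \<times> 'n"
    obtain i j where p: "p = (i, j)"
      by (cases p)
    have 1: "u $ i0 * x $ (i, j) = u $ i * x $ (i0, j)"
      using u by (simp add: splits_along_def)
    have 2: "v $ j0 * x $ (i0, j) = v $ j * x $ (i0, j0)"
      using v by (simp add: splits_along_def)
    have "(u $ i0 * v $ j0) * x $ (i, j) = v $ j0 * (u $ i0 * x $ (i, j))"
      by (simp add: mult_ac)
    also have "\<dots> = u $ i * (v $ j0 * x $ (i0, j))"
      by (simp add: 1 mult_ac)
    also have "\<dots> = u $ i * v $ j * x $ (i0, j0)"
      by (simp add: 2 mult_ac)
    finally have "(u $ i0 * v $ j0) * x $ (i, j) = u $ i * v $ j * x $ (i0, j0)" .
    then show "x $ p = ((x $ (i0, j0) / (u $ i0 * v $ j0)) *s outer u v) $ p"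
      using nz0 by (simp add: p field_simps)
  qed
  ultimately show "(x, W) \<in> nash_locus"
    using nz unfolding nash_locus_def by blast
qed

lemma closedin_nash_locus:
  "closedin (zariski_Gr (CARD('m::finite) + CARD('n::finite) - 1))
    (nash_locus :: (('k::field ^ ('m \<times> 'n)) \<times> ('k ^ ('m \<times> 'n)) set) set)"
proof (rule closedin_zariski_Gr)
  let ?N = "nash_locus :: (('k ^ ('m \<times> 'n)) \<times> ('k ^ ('m \<times> 'n)) set) set"
  show "?N \<subseteq> UNIV \<times> Gr (CARD('m) + CARD('n) - 1)"
    by (auto simp: nash_locus_iff_splits)
  fix B :: "('m \<times> 'n) set" assume B: "card B = CARD('m) + CARD('n) - 1"
  have "chart_preimage B ?N = {y. \<exists>u. splits_along id (\<chi> i. y $ Inl i) (chart_space B y) u TYPE('n)} \<inter>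
     {y. \<exists>v. splits_along prod.swap (\<chi> i. y $ Inl i) (chart_space B y) v TYPE('m)} \<inter> chart_dom B"
    using chart_space_in_Gr[of B] unfolding B
    by (auto simp: chart_preimage_def chart_eq nash_locus_iff_splits)
  then show "closedin (subtopology zariski (chart_dom B)) (chart_preimage B ?N)"
    unfolding closedin_subtopology
    using closedin_Int[OF closedin_splits_along[of id B] closedin_splits_along[of prod.swap B]] by blast
qed

text \<open>
  The chart coordinates of the point with parameters \<open>s\<close>. For \<open>c = (i, j)\<close> outside
  \<open>star i0 j0\<close> the only nonzero coefficients are those of \<open>w\<^sub>i\<^sub>j = u\<^sub>i
  w\<^sub>i\<^sub>0\<^sub>j + v\<^sub>j w\<^sub>i\<^sub>j\<^sub>0 - u\<^sub>i v\<^sub>j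
  w\<^sub>i\<^sub>0\<^sub>j\<^sub>0\<close>.
\<close>

definition nash_param ::
    "'m \<Rightarrow> 'n \<Rightarrow> 'k::field ^ ('m::finite \<times> 'n::finite) \<Rightarrow> 'k ^ (('m \<times> 'n) + ('m \<times> 'n) \<times> ('m \<times> 'n))" where
  "nash_param i0 j0 s = (\<chi> k. case k of
      Inl p \<Rightarrow> det_param i0 j0 s $ p
    | Inr (b, c) \<Rightarrow>
        if c \<in> star i0 j0 then 0
        else if b = (i0, j0) then - (row_param i0 j0 s $ fst c * col_param i0 j0 s $ snd c)
        else if b = (i0, snd c) then row_param i0 j0 s $ fst c
        else if b = (fst c, j0) then col_param i0 j0 s $ snd c
        else 0)"

lemma polymap_nash_param: "polymap (nash_param i0 j0)"
  unfolding polymap_def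
proof
  fix k
  show "polyfun (\<lambda>s. nash_param i0 j0 s $ k)"
  proof (cases k)
    case (Inl p)
    then show ?thesis
      by (simp add: nash_param_def polymap_det_param[unfolded polymap_def, rule_format])
  next
    case (Inr bc)
    obtain b c where bc: "bc = (b, c)"
      by (cases bc)
    show ?thesis
      unfolding nash_param_def Inr bc vec_lambda_beta sum.case prod.case
      by (intro polyfun_if polyfun_const polyfun_uminus polyfun_mult polyfun_row_col_param)
  qed
qed

lemma nash_param_in_chart_dom: "nash_param i0 j0 s \<in> chart_dom (star i0 j0)"
  by (auto simp: chart_dom_def nash_param_def star_def)

lemma chart_nash_param:
  fixes s :: "'k::field ^ ('m::finite \<times> 'n::finite)"
  shows "chart (star i0 j0) (nash_param i0 j0 s) = (det_param i0 j0 s, rank1_tangent (row_param i0 j0 s) (col_param i0 j0 s))"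
proof -
  let ?u = "row_param i0 j0 s" and ?v = "col_param i0 j0 s" and ?y = "nash_param i0 j0 s"
  have sum: "(\<Sum>b\<in>star i0 j0. ?y $ Inr (b, (i, j)) * w $ b) =
      ?u $ i * w $ (i0, j) + ?v $ j * w $ (i, j0) - ?u $ i * ?v $ j * w $ (i0, j0)"
    if "i \<noteq> i0" "j \<noteq> j0" for i j and w :: "'k ^ ('m \<times> 'n)"
  proof -
    have "(\<Sum>b\<in>star i0 j0. ?y $ Inr (b, (i, j)) * w $ b) =
        (\<Sum>b\<in>{(i0, j0), (i0, j), (i, j0)}. ?y $ Inr (b, (i, j)) * w $ b)"
      using that by (intro sum.mono_neutral_right) (auto simp: star_def nash_param_def)
    then show ?thesis
      using that by (simp add: nash_param_def star_def)
  qed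
  have "w \<in> chart_space (star i0 j0) ?y \<longleftrightarrow> w \<in> rank1_tangent ?u ?v" for w
  proof -
    have "w \<in> chart_space (star i0 j0) ?y \<longleftrightarrow> (\<forall>i j. i \<noteq> i0 \<and> j \<noteq> j0 \<longrightarrow>
        w $ (i, j) = ?u $ i * w $ (i0, j) + ?v $ j * w $ (i, j0) - ?u $ i * ?v $ j * w $ (i0, j0))"
      by (auto simp: chart_space_def sum star_def[of i0 j0, THEN arg_cong[of _ _ "\<lambda>S. _ \<in> S"]])
    also have "\<dots> \<longleftrightarrow> (\<forall>i j.
        w $ (i, j) = ?u $ i * w $ (i0, j) + ?v $ j * w $ (i, j0) - ?u $ i * ?v $ j * w $ (i0, j0))"
    proof -
      have "w $ (i, j) = ?u $ i * w $ (i0, j) + ?v $ j * w $ (i, j0) - ?u $ i * ?v $ j * w $ (i0, j0)"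
        if "i = i0 \<or> j = j0" for i j
        using that by auto
      then show ?thesis
        by blast
    qed
    also have "\<dots> \<longleftrightarrow> w \<in> rank1_tangent ?u ?v"
      by (subst rank1_tangent_iff[of _ i0 _ j0]) (simp_all add: eq_diff_eq mult_ac add_ac)
    finally show ?thesis .
  qed
  then have "chart_space (star i0 j0) ?y = rank1_tangent ?u ?v"
    by blast
  moreover have "(\<chi> i. ?y $ Inl i) = det_param i0 j0 s"
    by (simp add: vec_eq_iff nash_param_def)
  ultimately show ?thesis
    by (simp add: chart_eq)
qed

lemma nash_locus_cases:
  assumes "z \<in> nash_locus"
  obtains t u v i0 j0 where "z = (t *s outer u v, rank1_tangent u v)" "u $ i0 \<noteq> 0" "v $ j0 \<noteq> 0"
proof -
  obtain t u v where z: "z = (t *s outer u v, rank1_tangent u v)" "u \<noteq> 0" "v \<noteq> 0"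
    using assms by (auto simp: nash_locus_def)
  moreover obtain i0 j0 where "u $ i0 \<noteq> 0" "v $ j0 \<noteq> 0"
    using z(2,3) by (auto simp: vec_eq_iff)
  ultimately show ?thesis
    using that by blast
qed

text \<open>
  If \<open>u $ i0 = 0\<close>, then row \<open>i0\<close> of every matrix in \<open>rank1_tangent u v\<close>
  is a multiple of \<open>v\<close>. But in the chart this row can be prescribed arbitrarily, and it has at
  least two entries. Likewise for column \<open>j0\<close>.
\<close>

lemma pivots_nonzero_in_star_chart:
  assumes j1: "j1 \<noteq> j0" and i1: "i1 \<noteq> i0" and W: "chart_space (star i0 j0) y = rank1_tangent u v"
  shows "u $ i0 \<noteq> 0" "v $ j0 \<noteq> 0"
proof -
  have ex: "\<exists>a b. \<forall>c\<in>star i0 j0. (outer u a + outer b v) $ c = s $ c" for s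
  proof -
    obtain w where w: "w \<in> chart_space (star i0 j0) y" "\<And>c. c \<in> star i0 j0 \<Longrightarrow> w $ c = s $ c"
      using chart_space_extend[of "star i0 j0" y s] by blast
    from w(1) obtain a b where "w = outer u a + outer b v"
      unfolding W rank1_tangent_def by blast
    with w(2) show ?thesis
      by blast
  qed
  have star: "(i0, j) \<in> star i0 j0" "(i, j0) \<in> star i0 j0" for i j
    by (simp_all add: star_def)
  show "u $ i0 \<noteq> 0"
  proof
    assume "u $ i0 = 0"
    then have *: "\<exists>\<beta>. \<forall>j. \<beta> * v $ j = s $ (i0, j)" for s
      using ex[of s] star(1) by (metis (no_types, lifting) add_0 fst_conv mult_zero_left outer_nth snd_conv vector_add_component)
    obtain \<beta> where "\<forall>j. \<beta> * v $ j = axis (i0, j0) 1 $ (i0, j)"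
      using * by blast
    moreover obtain \<gamma> where "\<forall>j. \<gamma> * v $ j = axis (i0, j1) 1 $ (i0, j)"
      using * by blast
    ultimately have "\<beta> * v $ j0 = 1" "\<beta> * v $ j1 = 0" "\<gamma> * v $ j1 = 1"
      using j1 by (auto simp: axis_def)
    then show False
      by (metis mult_eq_0_iff mult_zero_left mult_zero_right zero_neq_one)
  qed
  show "v $ j0 \<noteq> 0"
  proof
    assume "v $ j0 = 0"
    then have *: "\<exists>\<beta>. \<forall>i. \<beta> * u $ i = s $ (i, j0)" for s
      using ex[of s] star(2) by (metis (no_types, lifting) add.right_neutral fst_conv mult.commute mult_zero_right outer_nth snd_conv vector_add_component)
    obtain \<beta> where "\<forall>i. \<beta> * u $ i = axis (i0, j0) 1 $ (i, j0)"
      using * by blast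
    moreover obtain \<gamma> where "\<forall>i. \<gamma> * u $ i = axis (i1, j0) 1 $ (i, j0)"
      using * by blast
    ultimately have "\<beta> * u $ i0 = 1" "\<beta> * u $ i1 = 0" "\<gamma> * u $ i1 = 1"
      using i1 by (auto simp: axis_def)
    then show False
      by (metis mult_eq_0_iff mult_zero_left mult_zero_right zero_neq_one)
  qed
qed

lemma chart_preimage_nash_locus:
  fixes i0 i1 :: "'m::finite" and j0 j1 :: "'n::finite"
  assumes "i1 \<noteq> i0" "j1 \<noteq> j0"
  shows "chart_preimage (star i0 j0) (nash_locus :: (('k::field ^ ('m \<times> 'n)) \<times> ('k ^ ('m \<times> 'n)) set) set) =
    nash_param i0 j0 ` coordspace (star i0 j0)"
proof (intro subset_antisym subsetI)
  fix y :: "'k ^ (('m \<times> 'n) + ('m \<times> 'n) \<times> ('m \<times> 'n))"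
  assume "y \<in> chart_preimage (star i0 j0) nash_locus"
  then have y: "y \<in> chart_dom (star i0 j0)" "chart (star i0 j0) y \<in> nash_locus"
    by (simp_all add: chart_preimage_def)
  then obtain t u v where tuv: "chart (star i0 j0) y = (t *s outer u v, rank1_tangent u v)"
    by (auto simp: nash_locus_def)
  then have "chart_space (star i0 j0) y = rank1_tangent u v"
    by (simp add: chart_eq)
  note nz = pivots_nonzero_in_star_chart[OF assms(2,1) this]
  obtain s where s: "s \<in> coordspace (star i0 j0)" "det_param i0 j0 s = t *s outer u v"
      "rank1_tangent (row_param i0 j0 s) (col_param i0 j0 s) = rank1_tangent u v"
    using ex_params[OF nz] by blast
  have "y = nash_param i0 j0 s"
    by (rule chart_inj[OF y(1) nash_param_in_chart_dom]) (simp add: chart_nash_param s tuv)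
  then show "y \<in> nash_param i0 j0 ` coordspace (star i0 j0)"
    using s(1) by blast
next
  fix y :: "'k ^ (('m \<times> 'n) + ('m \<times> 'n) \<times> ('m \<times> 'n))"
  assume "y \<in> nash_param i0 j0 ` coordspace (star i0 j0)"
  then obtain s where "y = nash_param i0 j0 s"
    by blast
  then have "chart (star i0 j0) y =
      (s $ (i0, j0) *s outer (row_param i0 j0 s) (col_param i0 j0 s), rank1_tangent (row_param i0 j0 s) (col_param i0 j0 s))"
    by (simp only: chart_nash_param det_param_def)
  then have "chart (star i0 j0) y \<in> nash_locus"
    unfolding nash_locus_def mem_Collect_eq
    by (intro exI conjI) (assumption, simp_all)
  then show "y \<in> chart_preimage (star i0 j0) nash_locus"
    by (simp add: chart_preimage_def nash_param_in_chart_dom \<open>y = nash_param i0 j0 s\<close>)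
qed

text \<open>
  Move only the parameter \<open>t\<close>: along this line, the basic open condition inside \<open>U\<close>
  is a nonzero polynomial in \<open>t\<close>, and multiplying it by \<open>t\<close> leaves a nonzero
  polynomial, which has a nonzero value; there \<open>t \<noteq> 0\<close> and the point lies in
  \<open>U\<close>.
\<close>

lemma open_nbhd_meets_gauss_graph:
  fixes U :: "(('k::alg_closed_field ^ ('m::finite \<times> 'n::finite)) \<times> ('k ^ ('m \<times> 'n)) set) set"
  assumes U: "openin (zariski_Gr (CARD('m) + CARD('n) - 1)) U" and z: "z \<in> nash_locus" "z \<in> U"
  obtains u v where "u \<noteq> 0" "v \<noteq> 0" "(outer u v, rank1_tangent u v) \<in> U"
proof -
  obtain t u v i0 j0 where z_eq: "z = (t *s outer u v, rank1_tangent u v)" and nz: "u $ i0 \<noteq> 0" "v $ j0 \<noteq> 0"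
    using z(1) by (rule nash_locus_cases)
  obtain s where s: "s \<in> coordspace (star i0 j0)" "det_param i0 j0 s = t *s outer u v"
      "rank1_tangent (row_param i0 j0 s) (col_param i0 j0 s) = rank1_tangent u v"
    using ex_params[OF nz] by blast
  have "chart (star i0 j0) (nash_param i0 j0 s) \<in> U"
    using z(2) by (simp add: chart_nash_param s z_eq)
  then obtain f where f: "polyfun f" "f (nash_param i0 j0 s) \<noteq> 0"
    "\<And>y'. y' \<in> chart_dom (star i0 j0) \<Longrightarrow> f y' \<noteq> 0 \<Longrightarrow> chart (star i0 j0) y' \<in> U"
    using openin_zariski_Gr_chart[OF U card_star nash_param_in_chart_dom] by blast
  define c where "c = (\<lambda>p. if p = (i0, j0) then [:0, 1:] else [:s $ p:])"
  obtain c' where c': "\<And>\<tau>. nash_param i0 j0 (curve c \<tau>) = curve c' \<tau>"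
    by (rule polymap_curve[OF polymap_nash_param, where c = c]) (rule that)
  obtain P where P: "\<And>\<tau>. f (curve c' \<tau>) = poly P \<tau>"
    by (rule polyfun_curve[OF f(1), where c = c']) (rule that)
  have "curve c (s $ (i0, j0)) = s"
    by (simp add: c_def vec_eq_iff)
  then have "P \<noteq> 0"
    using f(2) c' P by (metis poly_0)
  then have "P * [:0, 1:] \<noteq> 0"
    by simp
  then obtain \<tau> where "poly (P * [:0, 1:]) \<tau> \<noteq> 0"
    using poly_eqI_infinite[of "P * [:0, 1:]" 0] by (metis poly_0)
  then have \<tau>: "poly P \<tau> \<noteq> 0" "\<tau> \<noteq> 0"
    by auto
  let ?s = "curve c \<tau>"
  have "chart (star i0 j0) (nash_param i0 j0 ?s) \<in> U"
    using \<tau>(1) by (intro f(3) nash_param_in_chart_dom) (simp add: c' P)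
  then have in_U: "(det_param i0 j0 ?s, rank1_tangent (row_param i0 j0 ?s) (col_param i0 j0 ?s)) \<in> U"
    by (simp add: chart_nash_param)
  have "?s $ (i0, j0) = \<tau>"
    by (simp add: c_def)
  then have "det_param i0 j0 ?s = outer (\<tau> *s row_param i0 j0 ?s) (col_param i0 j0 ?s)"
    by (simp add: det_param_def outer_scale)
  moreover have "rank1_tangent (\<tau> *s row_param i0 j0 ?s) (col_param i0 j0 ?s) =
      rank1_tangent (row_param i0 j0 ?s) (col_param i0 j0 ?s)"
    using rank1_tangent_scale[of \<tau> 1] \<tau>(2) by simp
  ultimately show ?thesis
    using that[of "\<tau> *s row_param i0 j0 ?s" "col_param i0 j0 ?s"] in_U \<tau>(2) by simp
qed

lemma nash_blowup_generic_det2: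
  assumes "CARD('m::finite) \<ge> 2" "CARD('n::finite) \<ge> 2"
  shows "nash_blowup (generic_det2 :: ('k::alg_closed_field ^ ('m \<times> 'n)) set) = nash_locus"
proof -
  define d where "d = CARD('m) + CARD('n) - 1"
  let ?X = "generic_det2 :: ('k ^ ('m \<times> 'n)) set"
  let ?T = "subtopology (zariski_Gr d) (?X \<times> Gr d)"
  have sub: "nash_locus \<subseteq> ?X \<times> Gr d"
    using rank1_tangent_in_Gr by (auto simp: nash_locus_def d_def)
  have graph: "gauss_graph ?X \<subseteq> nash_locus"
  proof
    fix z assume "z \<in> gauss_graph ?X"
    then obtain u v where "z = (1 *s outer u v, rank1_tangent u v)" "u \<noteq> 0" "v \<noteq> 0"
      by (auto simp: gauss_graph_generic_det2[OF assms])
    then show "z \<in> nash_locus"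
      unfolding nash_locus_def by blast
  qed
  have closed: "closedin (zariski_Gr d) (nash_locus :: (('k ^ ('m \<times> 'n)) \<times> ('k ^ ('m \<times> 'n)) set) set)"
    unfolding d_def by (rule closedin_nash_locus)
  have "?T closure_of gauss_graph ?X \<subseteq> nash_locus"
  proof (rule closure_of_minimal[OF graph])
    show "closedin ?T nash_locus"
      unfolding closedin_subtopology using closed sub by blast
  qed
  moreover have "nash_locus \<subseteq> ?T closure_of gauss_graph ?X"
  proof
    fix z :: "('k ^ ('m \<times> 'n)) \<times> ('k ^ ('m \<times> 'n)) set" assume z: "z \<in> nash_locus"
    show "z \<in> ?T closure_of gauss_graph ?X"
      unfolding in_closure_of
    proof (intro conjI allI impI)
      show "z \<in> topspace ?T"
        using z sub closedin_subset[OF closed] by auto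
      fix V assume "z \<in> V \<and> openin ?T V"
      then obtain U where U: "openin (zariski_Gr d) U" "V = U \<inter> (?X \<times> Gr d)" "z \<in> U"
        by (auto simp: openin_subtopology)
      obtain u v where uv: "u \<noteq> 0" "v \<noteq> 0" "(outer u v, rank1_tangent u v) \<in> U"
        using open_nbhd_meets_gauss_graph[OF U(1)[unfolded d_def] z U(3)] by blast
      then have "(outer u v, rank1_tangent u v) \<in> gauss_graph ?X"
        unfolding gauss_graph_generic_det2[OF assms] by blast
      then show "\<exists>y. y \<in> gauss_graph ?X \<and> y \<in> V"
        using uv(3) U(2) graph sub by blast
    qed
  qed
  ultimately show ?thesis
    by (simp add: nash_blowup_def gauss_rank_generic_det2 d_def)
qed

lemma ex_other_element:
  assumes "CARD('a::finite) \<ge> 2" obtains b where "b \<noteq> (a :: 'a)"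
proof -
  have "UNIV \<noteq> {a}"
  proof
    assume "UNIV = {a}"
    then have "CARD('a) = card {a}"
      by (rule arg_cong)
    then show False
      using assms by simp
  qed
  then show ?thesis
    using that by blast
qed

theorem theorem2:
  assumes "CHAR('k::alg_closed_field) > 0"
    and "CARD('m::finite) \<ge> 2" and "CARD('n::finite) \<ge> 2"
  shows "nonsingular_nash_blowup (generic_det2 :: ('k ^ ('m \<times> 'n)) set)"
  unfolding nonsingular_nash_blowup_def nonsingular_Gr_def gauss_rank_generic_det2
    nash_blowup_generic_det2[OF assms(2,3)]
proof
  fix z :: "('k ^ ('m \<times> 'n)) \<times> ('k ^ ('m \<times> 'n)) set"
  assume "z \<in> nash_locus"
  then obtain t u v i0 j0 where z: "z = (t *s outer u v, rank1_tangent u v)" and nz: "u $ i0 \<noteq> 0" "v $ j0 \<noteq> 0"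
    by (rule nash_locus_cases)
  obtain s where s: "s \<in> coordspace (star i0 j0)" "det_param i0 j0 s = t *s outer u v"
      "rank1_tangent (row_param i0 j0 s) (col_param i0 j0 s) = rank1_tangent u v"
    using ex_params[OF nz] by blast
  obtain i1 where "i1 \<noteq> i0"
    by (rule ex_other_element[OF assms(2)])
  moreover obtain j1 where "j1 \<noteq> j0"
    by (rule ex_other_element[OF assms(3)])
  ultimately have ij: "i1 \<noteq> i0" "j1 \<noteq> j0"
    by simp_all
  (* the parameter at c is a coordinate of nash_param: t is an entry of the matrix, and u_i, v_j are
     coefficients in the chart equations of (i, j1) and (i1, j), which lie off the star *)
  define \<rho> where "\<rho> = (\<lambda>c. if c = (i0, j0) then Inl c
    else if snd c = j0 then Inr ((i0, j1), (fst c, j1)) else Inr ((i1, j0), (i1, snd c)))"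
  have retract: "nash_param i0 j0 r $ \<rho> c = r $ c" if "c \<in> star i0 j0" for r :: "'k ^ ('m \<times> 'n)" and c
    using that ij by (cases c)
      (auto simp: \<rho>_def nash_param_def star_def det_param_def row_param_def col_param_def)
  have "nonsingular_at (nash_param i0 j0 ` coordspace (star i0 j0)) (nash_param i0 j0 s)"
    by (rule nonsingular_at_section_image[OF polymap_nash_param retract imageI[OF s(1)]])
  then have "nonsingular_at (chart_preimage (star i0 j0) nash_locus) (nash_param i0 j0 s)"
    by (simp add: chart_preimage_nash_locus[OF ij])
  moreover have "chart (star i0 j0) (nash_param i0 j0 s) = z"
    by (simp add: chart_nash_param s z)
  ultimately show "\<exists>B y. card B = CARD('m) + CARD('n) - 1 \<and> y \<in> chart_dom B \<and> chart B y = z \<and>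
      nonsingular_at (chart_preimage B nash_locus) y"
    using card_star nash_param_in_chart_dom by blast
qed

end
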